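(* Let $G$ be a loopless multigraph. The polytope $P(M(G))$ is Gorenstein if and only if there exists an integer $\delta\ge2$ such that $G$ is a $(\delta-1)$-blow up of a simple graph $H=(V,E)$ satisfying $(\delta-1)|E(S)|+1=\delta(|S|-1)$ for every set $S\subset V$ inducing a 2-connected subgraph of $H$.
   Context: $P(M(G))$ is the convex hull in $\mathbb{R}^{E(G)}$ of indicator vectors of edge sets of forests of $G$. A normal lattice polytope $P$ is Gorenstein if it is $\delta$-Gorenstein for some positive integer $\delta$: regarding $P$ as full-dimensional in the affine lattice it spans, there is a lattice point $v\in\delta P$ such that every facet of the cone generated by $P\times\{1\}$ has reduced equation $h$ (primitive integral, nonnegative on the cone) with $h(v,\delta)=1$. The $m$-blow up of a simple graph is the multigraph on the same vertices with each edge replaced by $m$ parallel edges. $E(S)$ is the set of edges with both endpoints in $S$. A single edge counts as 2-connected. *)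

theory Defs
  imports "HOL-Analysis.Analysis"
begin

section \<open>Multigraphs and forests\<close>

record ('v, 'e) multigraph =
  mverts :: "'v set"
  medges :: "'e set"
  mends :: "'e \<Rightarrow> 'v set"

definition loopless_multigraph :: "('v, 'e) multigraph \<Rightarrow> bool" where
  "loopless_multigraph G \<longleftrightarrow> finite (mverts G) \<and> finite (medges G) \<and>
     (\<forall>e\<in>medges G. mends G e \<subseteq> mverts G \<and> card (mends G e) = 2)"

text \<open>A cycle of length k has distinct vertices v(0), ..., v(k-1) and distinct edges
  e(0), ..., e(k-1), where e(i) joins v(i) and v(i+1 mod k).  Hence two parallel edges form a
  cycle of length 2 (and a loop would be a cycle of length 1).\<close>

definition is_cycle :: "('v, 'e) multigraph \<Rightarrow> 'v list \<Rightarrow> 'e list \<Rightarrow> bool" where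
  "is_cycle G vs es \<longleftrightarrow> length es = length vs \<and> 1 \<le> length es \<and>
     distinct vs \<and> distinct es \<and> set es \<subseteq> medges G \<and>
     (\<forall>i<length es. mends G (es ! i) = {vs ! i, vs ! (Suc i mod length es)})"

definition is_forest :: "('v, 'e) multigraph \<Rightarrow> 'e set \<Rightarrow> bool" where
  "is_forest G F \<longleftrightarrow> F \<subseteq> medges G \<and> (\<nexists>vs es. is_cycle G vs es \<and> set es \<subseteq> F)"

text \<open>The polytope P(M(G)).  The edge set may be any subset of the finite type of edge names (so
  that it may be empty); the space with coordinates in E(G) is identified with the coordinate
  subspace of vectors vanishing outside E(G).\<close>

definition forest_polytope :: "('v, 'e::finite) multigraph \<Rightarrow> (real ^ 'e) set" where
  "forest_polytope G = convex hull {(\<chi> e. indicator F e) | F. is_forest G F}"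


section \<open>Simple graphs\<close>

definition simple_graph :: "'v set \<Rightarrow> 'v set set \<Rightarrow> bool" where
  "simple_graph V E \<longleftrightarrow> finite V \<and> (\<forall>d\<in>E. d \<subseteq> V \<and> card d = 2)"

definition is_blow_up :: "nat \<Rightarrow> 'v set \<Rightarrow> 'v set set \<Rightarrow> ('v, 'e) multigraph \<Rightarrow> bool" where
  "is_blow_up m V E G \<longleftrightarrow> mverts G = V \<and> (\<forall>e\<in>medges G. mends G e \<in> E) \<and>
     (\<forall>d\<in>E. card {e \<in> medges G. mends G e = d} = m)"

definition induced_edges :: "'v set set \<Rightarrow> 'v set \<Rightarrow> 'v set set" where
  "induced_edges E S = {d \<in> E. d \<subseteq> S}"

definition graph_connected :: "'v set \<Rightarrow> 'v set set \<Rightarrow> bool" where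
  "graph_connected V E \<longleftrightarrow> V \<noteq> {} \<and>
     (\<forall>u\<in>V. \<forall>v\<in>V. (u, v) \<in> {(x, y). x \<in> V \<and> y \<in> V \<and> {x, y} \<in> E}\<^sup>*)"

text \<open>At least two vertices, connected, no cut vertex.  A single edge is 2-connected,
  a single vertex is not.\<close>

definition two_connected :: "'v set \<Rightarrow> 'v set set \<Rightarrow> bool" where
  "two_connected V E \<longleftrightarrow> 2 \<le> card V \<and> graph_connected V E \<and>
     (\<forall>v\<in>V. graph_connected (V - {v}) (induced_edges E (V - {v})))"


section \<open>Gorenstein polytopes\<close>

definition lattice_polytope :: "(real ^ 'n) set \<Rightarrow> bool" where
  "lattice_polytope P \<longleftrightarrow>
     (\<exists>X. finite X \<and> (\<forall>x\<in>X. \<forall>i. x $ i \<in> \<int>) \<and> P = convex hull X)"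

definition lattice_points :: "(real ^ 'n) set \<Rightarrow> (real ^ 'n) set" where
  "lattice_points P = {x \<in> P. \<forall>i. x $ i \<in> \<int>}"

text \<open>The group generated by the points (x, 1) with x a lattice point of P.  Its elements at
  height 1 form the affine lattice spanned by P, and its elements (x, k) are the lattice points
  at height k; in particular the lattice points of the dilate kP are the x in kP for which
  (x, k) belongs to this group.\<close>

definition spanned_lattice :: "(real ^ 'n) set \<Rightarrow> ((real ^ 'n) \<times> real) set" where
  "spanned_lattice P =
     {(\<Sum>x\<in>X. of_int (c x) *\<^sub>R (x, 1)) | X (c :: real ^ 'n \<Rightarrow> int).
        finite X \<and> X \<subseteq> lattice_points P}"

definition dilate_lattice_points :: "nat \<Rightarrow> (real ^ 'n) set \<Rightarrow> (real ^ 'n) set" where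
  "dilate_lattice_points k P =
     {x \<in> (*\<^sub>R) (real k) ` P. (x, real k) \<in> spanned_lattice P}"

definition normal_polytope :: "(real ^ 'n) set \<Rightarrow> bool" where
  "normal_polytope P \<longleftrightarrow>
     (\<forall>k>0. \<forall>x\<in>dilate_lattice_points k P.
        \<exists>p :: nat \<Rightarrow> real ^ 'n. (\<forall>i<k. p i \<in> lattice_points P) \<and> x = (\<Sum>i<k. p i))"

definition polytope_cone :: "(real ^ 'n) set \<Rightarrow> ((real ^ 'n) \<times> real) set" where
  "polytope_cone P = conic hull (P \<times> {1})"

text \<open>The linear form is given on the whole ambient space, but all conditions concern only its
  restriction to the linear span of the cone, on which it is uniquely determined.  The last two
  conditions say that it is a primitive element of the dual of the spanned lattice.\<close>

definition reduced_equation ::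
  "(real ^ 'n) set \<Rightarrow> ((real ^ 'n) \<times> real) set \<Rightarrow> ((real ^ 'n) \<times> real \<Rightarrow> real) \<Rightarrow> bool" where
  "reduced_equation P F h \<longleftrightarrow> linear h \<and>
     (\<forall>z\<in>polytope_cone P. 0 \<le> h z) \<and> F = {z \<in> polytope_cone P. h z = 0} \<and>
     (\<forall>z\<in>spanned_lattice P. h z \<in> \<int>) \<and>
     \<not> (\<exists>k::nat. 2 \<le> k \<and> (\<forall>z\<in>spanned_lattice P. h z / real k \<in> \<int>))"

definition delta_gorenstein :: "nat \<Rightarrow> (real ^ 'n) set \<Rightarrow> bool" where
  "delta_gorenstein \<delta> P \<longleftrightarrow>
     (\<exists>v\<in>dilate_lattice_points \<delta> P.
        \<forall>F. F facet_of polytope_cone P \<longrightarrow>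
          (\<exists>h. reduced_equation P F h \<and> h (v, real \<delta>) = 1))"

definition gorenstein :: "(real ^ 'n) set \<Rightarrow> bool" where
  "gorenstein P \<longleftrightarrow> lattice_polytope P \<and> normal_polytope P \<and>
     (\<exists>\<delta>>0. delta_gorenstein \<delta> P)"

end

theory Submission
  imports Defs
begin

text \<open>Counting components gives the rank function r of the graphic matroid. If r bounds the sums of a
  nonnegative integer vector y over all edge sets up to a factor k, then y is a sum of k forests
  (matroid partition). This yields both normality and, by rational approximation, the inequalities
  of the forest polytope. Splitting vertex sets at cut vertices reduces these to x(e) \<ge> 0 and
  x(E(S)) \<le> |S| - 1 for 2-connected S, all of which define facets with primitive equations.
  So v is the all-ones vector, and the Gorenstein condition says \<delta>(|S| - 1) - |E(S)| = 1 for
  each such S. Its instance where S is the vertex pair of an edge fixes all edge multiplicities.\<close>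

section \<open>Matroid partition\<close>

text \<open>The two directions need different knowledge about facets. From Gorenstein to the
  equations, each listed form has to cut out a facet and be primitive, so that it takes the value 1
  at v. Conversely it is enough that every facet is cut out by some listed form: an integral form
  with value 1 at a lattice point is automatically primitive. The ambient space has a coordinate for
  every edge name, including names outside \<open>medges G\<close>, so the cone may be
  lower-dimensional. An equation of a facet is therefore determined only on the span of the cone,
  and forms are compared only on lattice points. A pair of vertices joined by m edges gives \<delta>
  - m = 1, which is the origin of the factor \<delta> - 1. A graph without edges is a genuine
  exception: its cone is a ray whose only facet, the origin, is cut out by the height and by no form
  on the list.\<close>

locale matroid_rank =
  fixes r :: "'e::finite set \<Rightarrow> nat"
  assumes rank_empty: "r {} = 0"
    and rank_insert_ge: "r A \<le> r (insert e A)"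
    and rank_insert_le: "r (insert e A) \<le> Suc (r A)"
    and rank_insert_eq: "A \<subseteq> B \<Longrightarrow> r (insert e A) = r A \<Longrightarrow> r (insert e B) = r B"
begin

text \<open>One element raises the rank by 0 or 1, so \<open>rank_insert_eq\<close> says that its
  gain over a larger set is never larger. Adding up these gains over X gives the inequality, and
  submodularity is the case where A is an intersection.\<close>

lemma rank_diminishing:
  assumes "A \<subseteq> B"
  shows "r (B \<union> X) + r A \<le> r B + r (A \<union> X)"
proof -
  have "finite X" by simp
  then show ?thesis
  proof (induction X)
    case empty
    then show ?case by simp
  next
    case (insert e X)
    have "r (insert e (B \<union> X)) + r (A \<union> X) \<le> r (B \<union> X) + r (insert e (A \<union> X))"
      using rank_insert_eq[of "A \<union> X" "B \<union> X" e] assms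
        rank_insert_ge[of "A \<union> X" e] rank_insert_le[of e "A \<union> X"] rank_insert_le[of e "B \<union> X"]
      by fastforce
    then show ?case using insert.IH by simp
  qed
qed

lemma rank_submodular: "r (A \<union> B) + r (A \<inter> B) \<le> r A + r B"
  using rank_diminishing[of "A \<inter> B" A B] by (simp add: Un_commute Int_commute Un_Int_distrib)

lemma rank_Un_le: "r (A \<union> X) \<le> r A + card X"
proof -
  have "finite X" by simp
  then show ?thesis
  proof (induction X)
    case empty
    then show ?case by simp
  next
    case (insert e X)
    then show ?case using rank_insert_le[of e "A \<union> X"] by simp
  qed
qed

lemma rank_le_card: "r A \<le> card A"
  using rank_Un_le[of "{}" A] by (simp add: rank_empty)

lemma rank_mono:
  assumes "A \<subseteq> B"
  shows "r A \<le> r B"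
proof -
  have "r A \<le> r (A \<union> B)"
  proof -
    have "finite B" by simp
    then show ?thesis
    proof (induction B)
      case (insert e B)
      then show ?case using rank_insert_ge[of "A \<union> B" e] by simp
    qed simp
  qed
  then show ?thesis using assms by (simp add: sup.absorb2)
qed

definition indep :: "'e set \<Rightarrow> bool" where
  "indep F \<longleftrightarrow> r F = card F"

lemma indep_subset:
  assumes "indep F" "F' \<subseteq> F"
  shows "indep F'"
proof -
  have "r F \<le> r F' + card (F - F')"
    using rank_Un_le[of F' "F - F'"] assms by (simp add: Un_absorb1)
  moreover have "card F = card F' + card (F - F')"
    using assms by (metis card_Un_disjoint Diff_disjoint Diff_partition finite)
  ultimately show ?thesis
    using assms rank_le_card[of F'] by (simp add: indep_def)
qed

lemma basis_exists: "\<exists>T\<subseteq>A. indep T \<and> r T = r A"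
proof -
  have "finite A" by simp
  then show ?thesis
  proof (induction A)
    case empty
    then show ?case by (auto simp: indep_def rank_empty)
  next
    case (insert e A)
    then obtain T where T: "T \<subseteq> A" "indep T" "r T = r A" by blast
    show ?case
    proof (cases "r (insert e A) = r A")
      case True
      then show ?thesis using T by auto
    next
      case False
      then have 1: "r (insert e A) = Suc (r A)"
        using rank_insert_le[of e A] rank_insert_ge[of A e] by linarith
      have "r (insert e T) \<noteq> r T"
        using rank_insert_eq[OF T(1), of e] False by blast
      then have 2: "r (insert e T) = Suc (r T)"
        using rank_insert_le[of e T] rank_insert_ge[of T e] by linarith
      then have "indep (insert e T)"
        using T insert.hyps(2) by (simp add: indep_def card_insert_if subset_iff) metis
      then show ?thesis using 1 2 T by (intro exI[of _ "insert e T"]) auto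
    qed
  qed
qed

text \<open>An element e of positive demand can be put into some I i unless each i has a tight set A i
  without e such that A i and I i together span e; tight sets are closed under union, and the union
  of the A i would violate the rank condition after adding e.\<close>

lemma indep_extension:
  fixes y :: "'e \<Rightarrow> nat" and I :: "nat \<Rightarrow> 'e set"
  assumes "\<And>i. i < k \<Longrightarrow> indep (I i)"
    and "\<And>A. sum y A + (\<Sum>i<k. card (I i)) \<le> (\<Sum>i<k. r (A \<union> I i))"
  shows "\<exists>J. (\<forall>i<k. indep (J i)) \<and>
    (\<forall>e. (\<Sum>i<k. of_bool (e \<in> J i)) = y e + (\<Sum>i<k. of_bool (e \<in> I i)))"
  using assms
proof (induction "sum y UNIV" arbitrary: y I)
  case 0
  then show ?case by (intro exI[of _ I]) auto
next
  case (Suc n)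
  note ind = Suc.prems(1) and bound = Suc.prems(2)
  from Suc.hyps(2) obtain e where e: "y e > 0"
    by (metis finite gr0I sum.neutral zero_less_Suc less_irrefl)
  define tight where
    "tight A \<longleftrightarrow> sum y A + (\<Sum>i<k. card (I i)) = (\<Sum>i<k. r (A \<union> I i))" for A
  define y' where "y' = y(e := y e - 1)"
  have tight_empty: "tight {}"
    unfolding tight_def using ind by (simp add: indep_def)
  \<comment> \<open>Uncrossing: the left side of \<open>bound\<close> is modular in A and the right
    side submodular. Equality at A and at B, with \<open>bound\<close> at the intersection, forces
    equality at the union.\<close>
  have tight_Un: "tight (A \<union> B)" if "tight A" "tight B" for A B
  proof -
    have "(\<Sum>i<k. r ((A \<union> B) \<union> I i)) + (\<Sum>i<k. r ((A \<inter> B) \<union> I i))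
        \<le> (\<Sum>i<k. r (A \<union> I i)) + (\<Sum>i<k. r (B \<union> I i))"
      unfolding sum.distrib[symmetric]
    proof (rule sum_mono)
      fix i
      show "r ((A \<union> B) \<union> I i) + r ((A \<inter> B) \<union> I i) \<le> r (A \<union> I i) + r (B \<union> I i)"
        using rank_submodular[of "A \<union> I i" "B \<union> I i"]
        by (metis Un_Int_distrib2 Un_assoc Un_commute Un_left_absorb)
    qed
    moreover have "sum y (A \<union> B) + sum y (A \<inter> B) = sum y A + sum y B"
      by (rule sum.union_inter) auto
    ultimately show ?thesis
      using that bound[of "A \<union> B"] bound[of "A \<inter> B"] unfolding tight_def by linarith
  qed
  have sum_y': "sum y A = sum y' A + of_bool (e \<in> A)" for A
  proof (cases "e \<in> A")
    case True
    have "sum y A = y e + sum y (A - {e})" "sum y' A = y' e + sum y' (A - {e})"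
      using True by (auto intro: sum.remove)
    moreover have "sum y' (A - {e}) = sum y (A - {e})"
      by (rule sum.cong) (auto simp: y'_def)
    ultimately show ?thesis using e True by (simp add: y'_def)
  next
    case False
    then have "sum y' A = sum y A"
      by (intro sum.cong) (auto simp: y'_def)
    with False show ?thesis by simp
  qed
  have "\<exists>i<k. \<forall>A. tight A \<longrightarrow> e \<notin> A \<longrightarrow> r (insert e (A \<union> I i)) = Suc (r (A \<union> I i))"
  proof (rule ccontr)
    assume "\<not> ?thesis"
    then have "\<forall>i. \<exists>A. i < k \<longrightarrow> tight A \<and> e \<notin> A \<and> r (insert e (A \<union> I i)) \<noteq> Suc (r (A \<union> I i))"
      by blast
    then obtain A where A: "\<And>i. i < k \<Longrightarrow> tight (A i)" "\<And>i. i < k \<Longrightarrow> e \<notin> A i"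
      "\<And>i. i < k \<Longrightarrow> r (insert e (A i \<union> I i)) \<noteq> Suc (r (A i \<union> I i))"
      by metis
    define T where "T = (\<Union>i<k. A i)"
    have "tight (\<Union>i<j. A i)" if "j \<le> k" for j
      using that
    proof (induction j)
      case 0
      then show ?case using tight_empty by simp
    next
      case (Suc j)
      then show ?case using A(1)[of j] tight_Un by (simp add: lessThan_Suc)
    qed
    then have T: "tight T" unfolding T_def by blast
    have eT: "e \<notin> T" using A(2) by (auto simp: T_def)
    have "r (insert e T \<union> I i) = r (T \<union> I i)" if "i < k" for i
    proof -
      have "r (insert e (A i \<union> I i)) = r (A i \<union> I i)"
        using A(3)[OF that] rank_insert_le[of e "A i \<union> I i"] rank_insert_ge[of "A i \<union> I i" e]
        by linarith
      moreover have "A i \<union> I i \<subseteq> T \<union> I i" using that by (auto simp: T_def)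
      ultimately show ?thesis using rank_insert_eq[of "A i \<union> I i" "T \<union> I i" e] by simp
    qed
    then have "(\<Sum>i<k. r (insert e T \<union> I i)) = (\<Sum>i<k. r (T \<union> I i))" by simp
    then show False
      using bound[of "insert e T"] T eT e unfolding tight_def by simp
  qed
  then obtain j where j: "j < k"
    "\<And>A. tight A \<Longrightarrow> e \<notin> A \<Longrightarrow> r (insert e (A \<union> I j)) = Suc (r (A \<union> I j))"
    by blast
  define I' where "I' = I(j := insert e (I j))"
  have "r (insert e (I j)) = Suc (r (I j))" using j(2)[OF tight_empty] by simp
  then have eIj: "e \<notin> I j" and ind_j: "indep (insert e (I j))"
    using ind[OF j(1)] by (auto simp: indep_def insert_absorb)
      (metis Suc_n_not_n insert_absorb card_insert_disjoint finite)+
  have split_k: "(\<Sum>i<k. f i) = f j + (\<Sum>i\<in>{..<k}-{j}. f i)" for f :: "nat \<Rightarrow> nat"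
    using j(1) by (intro sum.remove) auto
  have card': "(\<Sum>i<k. card (I' i)) = Suc (\<Sum>i<k. card (I i))"
    unfolding split_k using eIj by (simp add: I'_def)
  have rank': "(\<Sum>i<k. r (A \<union> I' i)) + r (A \<union> I j) = (\<Sum>i<k. r (A \<union> I i)) + r (insert e (A \<union> I j))" for A
    unfolding split_k by (simp add: I'_def)
  have "\<exists>J. (\<forall>i<k. indep (J i)) \<and>
    (\<forall>e. (\<Sum>i<k. of_bool (e \<in> J i)) = y' e + (\<Sum>i<k. of_bool (e \<in> I' i)))"
  proof (rule Suc.hyps(1))
    show "n = sum y' UNIV" using Suc.hyps(2) sum_y'[of UNIV] by simp
    show "indep (I' i)" if "i < k" for i
      using that ind ind_j by (simp add: I'_def)
    show "sum y' A + (\<Sum>i<k. card (I' i)) \<le> (\<Sum>i<k. r (A \<union> I' i))" for A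
    \<comment> \<open>If e lies in A, neither side changes. Otherwise the left side grows by 1,
      which is paid for by the rank gain from the choice of j when A is tight, and by the existing
      gap when it is not.\<close>
    proof (cases "e \<in> A")
      case True
      then show ?thesis
        using bound[of A] card' rank'[of A] sum_y'[of A] by (simp add: insert_absorb)
    next
      case False
      show ?thesis
      proof (cases "tight A")
        case True
        then show ?thesis
          using False j(2)[OF True False] card' rank'[of A] sum_y'[of A]
          unfolding tight_def by simp
      next
        case nt: False
        then show ?thesis
          using False bound[of A] card' rank'[of A] sum_y'[of A] rank_insert_ge[of "A \<union> I j" e]
          unfolding tight_def by simp
      qed
    qed
  qed
  then obtain J where J: "\<forall>i<k. indep (J i)"
    "\<And>d. (\<Sum>i<k. of_bool (d \<in> J i)) = y' d + (\<Sum>i<k. of_bool (d \<in> I' i))"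
    by auto
  have "y' d + (\<Sum>i<k. of_bool (d \<in> I' i)) = y d + (\<Sum>i<k. of_bool (d \<in> I i))" for d
    unfolding split_k using e eIj by (auto simp: y'_def I'_def)
  then show ?case using J by metis
qed

corollary indep_decomposition:
  fixes y :: "'e \<Rightarrow> nat"
  assumes "\<And>A. sum y A \<le> k * r A"
  shows "\<exists>J. (\<forall>i<k. indep (J i)) \<and> (\<forall>e. (\<Sum>i<k. of_bool (e \<in> J i)) = y e)"
  using indep_extension[of k "\<lambda>_. {}" y] assms by (simp add: indep_def rank_empty)

end

section \<open>Integer decomposition and the inequalities of the independence polytope\<close>

abbreviation ind_vec :: "'e set \<Rightarrow> real ^ 'e" where
  "ind_vec F \<equiv> (\<chi> e. indicator F e)"

context matroid_rank
begin

definition indep_polytope :: "(real ^ 'e) set" where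
  "indep_polytope = convex hull {ind_vec F | F. indep F}"

text \<open>Serves twice: for the rounded vectors that approximate a point of the polytope, and for
  the lattice points of dilates in the proof of normality.\<close>

lemma decomposition_real:
  fixes x :: "real ^ 'e"
  assumes "\<And>e. x $ e \<in> \<int>" "\<And>e. 0 \<le> x $ e" "\<And>A. (\<Sum>e\<in>A. x $ e) \<le> real k * r A"
  shows "\<exists>J. (\<forall>i<k. indep (J i)) \<and> x = (\<Sum>i<k. ind_vec (J i))"
proof -
  define y where "y e = nat \<lfloor>x $ e\<rfloor>" for e
  have y: "x $ e = real (y e)" for e
    using assms(1,2)[of e] by (simp add: y_def)
  have "sum y A \<le> k * r A" for A
    using assms(3)[of A] unfolding y by (simp flip: of_nat_sum of_nat_mult)
  then obtain J where J: "\<forall>i<k. indep (J i)" "\<And>e. (\<Sum>i<k. of_bool (e \<in> J i)) = y e"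
    using indep_decomposition[of y k] by auto
  have "x = (\<Sum>i<k. ind_vec (J i))"
  proof (rule vec_eq_iff[THEN iffD2], rule allI)
    fix e
    have "x $ e = real (\<Sum>i<k. of_bool (e \<in> J i))" using J(2) y by simp
    then show "x $ e = (\<Sum>i<k. ind_vec (J i)) $ e"
      by (simp add: indicator_def of_bool_def if_distrib cong: if_cong)
  qed
  with J show ?thesis by auto
qed

theorem indep_polytope_eq:
  "indep_polytope = {x. (\<forall>e. 0 \<le> x $ e) \<and> (\<forall>A. (\<Sum>e\<in>A. x $ e) \<le> r A)}" (is "_ = ?Q")
proof
  show "indep_polytope \<subseteq> ?Q"
    unfolding indep_polytope_def
  proof (rule hull_minimal)
    show "convex ?Q"
    proof (rule convexI)
      fix x y :: "real ^ 'e" and u v :: real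
      assume *: "x \<in> ?Q" "y \<in> ?Q" "0 \<le> u" "0 \<le> v" "u + v = 1"
      have "(\<Sum>e\<in>A. (u *\<^sub>R x + v *\<^sub>R y) $ e) \<le> r A" for A
      proof -
        have "(\<Sum>e\<in>A. (u *\<^sub>R x + v *\<^sub>R y) $ e) = u * (\<Sum>e\<in>A. x $ e) + v * (\<Sum>e\<in>A. y $ e)"
          by (simp add: sum.distrib sum_distrib_left)
        also have "\<dots> \<le> u * r A + v * r A"
          using * by (intro add_mono mult_left_mono) auto
        also have "\<dots> = r A" using *(5) by (simp flip: distrib_right)
        finally show ?thesis .
      qed
      then show "u *\<^sub>R x + v *\<^sub>R y \<in> ?Q" using * by auto
    qed
    have "(\<Sum>e\<in>A. indicator F e :: real) \<le> r A" if "indep F" for F A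
    proof -
      have "(\<Sum>e\<in>A. indicator F e :: real) = card (F \<inter> A)"
        by (simp add: indicator_def sum.If_cases Int_commute)
      also have "\<dots> = r (F \<inter> A)"
        using indep_subset[OF that, of "F \<inter> A"] by (simp add: indep_def)
      also have "\<dots> \<le> r A" using rank_mono[of "F \<inter> A" A] by simp
      finally show ?thesis .
    qed
    then show "{ind_vec F | F. indep F} \<subseteq> ?Q" by auto
  qed
next
  show "?Q \<subseteq> indep_polytope"
  proof
    fix x assume x: "x \<in> ?Q"
    \<comment> \<open>Rounding (n + 1) x down keeps nonnegativity and all upper bounds. So
      \<open>z n\<close> is a sum of n + 1 indicator vectors, and dividing by n + 1 makes it their
      average, a point of the polytope at coordinatewise distance at most 1/(n + 1) from x.\<close>
    define z where "z n = (\<chi> e. real_of_int \<lfloor>real (Suc n) * x $ e\<rfloor>)" for n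
    have z_le: "z n $ e \<le> real (Suc n) * x $ e" for n e
      unfolding z_def by (simp only: vec_lambda_beta of_int_floor_le)
    have "z n /\<^sub>R real (Suc n) \<in> indep_polytope" for n
    proof -
      have "\<exists>J. (\<forall>i<Suc n. indep (J i)) \<and> z n = (\<Sum>i<Suc n. ind_vec (J i))"
      proof (rule decomposition_real)
        show "z n $ e \<in> \<int>" for e by (simp add: z_def)
        show "0 \<le> z n $ e" for e using x by (simp add: z_def)
        show "(\<Sum>e\<in>A. z n $ e) \<le> real (Suc n) * r A" for A
        proof -
          have "(\<Sum>e\<in>A. z n $ e) \<le> real (Suc n) * (\<Sum>e\<in>A. x $ e)"
            unfolding sum_distrib_left by (rule sum_mono) (rule z_le)
          also have "\<dots> \<le> real (Suc n) * r A"
            using x by (intro mult_left_mono) auto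
          finally show ?thesis .
        qed
      qed
      then obtain J where J: "\<forall>i<Suc n. indep (J i)" "z n = (\<Sum>i<Suc n. ind_vec (J i))"
        by blast
      have "(\<Sum>i<Suc n. inverse (real (Suc n)) *\<^sub>R ind_vec (J i)) \<in> indep_polytope"
        unfolding indep_polytope_def
      proof (rule convex_sum)
        show "ind_vec (J i) \<in> convex hull {ind_vec F | F. indep F}" if "i \<in> {..<Suc n}" for i
          using J(1) that by (intro hull_inc) auto
      qed (auto simp: convex_convex_hull)
      then show ?thesis unfolding J(2) by (simp only: scaleR_right.sum)
    qed
    moreover have "(\<lambda>n. z n /\<^sub>R real (Suc n)) \<longlonglongrightarrow> x"
    proof (rule vec_tendstoI)
      fix e
      show "(\<lambda>n. (z n /\<^sub>R real (Suc n)) $ e) \<longlonglongrightarrow> x $ e"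
      proof (rule real_tendsto_sandwich)
        show "\<forall>\<^sub>F n in sequentially. x $ e - 1 / real (Suc n) \<le> (z n /\<^sub>R real (Suc n)) $ e"
        proof (rule always_eventually, rule allI)
          fix n
          have "real (Suc n) * x $ e - 1 \<le> z n $ e"
            unfolding z_def by (simp only: vec_lambda_beta) linarith
          then have "(real (Suc n) * x $ e - 1) / real (Suc n) \<le> z n $ e / real (Suc n)"
            by (rule divide_right_mono) simp
          moreover have "(real (Suc n) * x $ e - 1) / real (Suc n) = x $ e - 1 / real (Suc n)"
            by (simp add: field_simps)
          moreover have "(z n /\<^sub>R real (Suc n)) $ e = z n $ e / real (Suc n)"
            by (simp add: divide_inverse_commute)
          ultimately show "x $ e - 1 / real (Suc n) \<le> (z n /\<^sub>R real (Suc n)) $ e"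
            by (simp only:)
        qed
        show "\<forall>\<^sub>F n in sequentially. (z n /\<^sub>R real (Suc n)) $ e \<le> x $ e"
        proof (rule always_eventually, rule allI)
          fix n
          show "(z n /\<^sub>R real (Suc n)) $ e \<le> x $ e"
            using z_le[of n e] by (simp add: field_simps)
        qed
        show "(\<lambda>n. x $ e - 1 / real (Suc n)) \<longlonglongrightarrow> x $ e"
          using tendsto_diff[OF tendsto_const LIMSEQ_inverse_real_of_nat, of "x $ e"]
          by (simp add: inverse_eq_divide)
      qed simp
    qed
    moreover have "closed indep_polytope"
    proof -
      have "{ind_vec F | F. indep F} = ind_vec ` {F. indep F}" by auto
      then have "finite {ind_vec F | F. indep F}" by simp
      then show ?thesis
        unfolding indep_polytope_def
        by (simp add: finite_imp_compact_convex_hull compact_imp_closed)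
    qed
    ultimately show "x \<in> indep_polytope"
      by (metis (no_types, lifting) closed_sequentially)
  qed
qed

end

section \<open>The graphic matroid\<close>

locale loopless_graph =
  fixes G :: "('v, 'e::finite) multigraph"
  assumes loopless: "loopless_multigraph G"
begin

abbreviation V where "V \<equiv> mverts G"
abbreviation E where "E \<equiv> medges G"
abbreviation ends where "ends \<equiv> mends G"

lemma finite_V: "finite V"
  using loopless by (simp add: loopless_multigraph_def)

lemma ends_subset: "e \<in> E \<Longrightarrow> ends e \<subseteq> V"
  and card_ends: "e \<in> E \<Longrightarrow> card (ends e) = 2"
  using loopless by (auto simp: loopless_multigraph_def)

lemma obtain_ends:
  assumes "e \<in> E"
  obtains u w where "ends e = {u, w}" "u \<noteq> w" "u \<in> V" "w \<in> V"
  using card_ends[OF assms] ends_subset[OF assms] by (auto simp: card_2_iff)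

text \<open>The matroid lives on the whole type of edge names. Intersecting with \<open>E\<close>
  keeps names outside the graph from connecting anything.\<close>

definition adj :: "'e set \<Rightarrow> ('v \<times> 'v) set" where
  "adj A = {(x, y). \<exists>e\<in>A \<inter> E. ends e = {x, y}}"

definition reach :: "'e set \<Rightarrow> ('v \<times> 'v) set" where
  "reach A = (adj A)\<^sup>*"

lemma adj_sym: "(x, y) \<in> adj A \<Longrightarrow> (y, x) \<in> adj A"
  by (auto simp: adj_def insert_commute)

lemma reach_sym: "(x, y) \<in> reach A \<Longrightarrow> (y, x) \<in> reach A"
  unfolding reach_def using symD[OF sym_rtrancl[of "adj A"]] adj_sym by (metis symI)

lemma reach_trans: "(x, y) \<in> reach A \<Longrightarrow> (y, z) \<in> reach A \<Longrightarrow> (x, z) \<in> reach A"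
  by (simp add: reach_def)

lemma reach_refl [simp]: "(x, x) \<in> reach A"
  by (simp add: reach_def)

lemma equiv_reach: "equiv UNIV (reach A)"
  by (intro equivI refl_onI symI transI) (auto intro: reach_sym reach_trans)

lemma reach_class_eq_iff: "reach A `` {x} = reach A `` {y} \<longleftrightarrow> (x, y) \<in> reach A"
  using eq_equiv_class_iff[OF equiv_reach] by simp

lemma reach_mono: "A \<subseteq> B \<Longrightarrow> reach A \<subseteq> reach B"
  unfolding reach_def by (rule rtrancl_mono) (auto simp: adj_def)

lemma edge_reach: "e \<in> A \<Longrightarrow> e \<in> E \<Longrightarrow> ends e = {x, y} \<Longrightarrow> (x, y) \<in> reach A"
  by (auto simp: reach_def adj_def)

text \<open>Quantifying over both orders of the ends avoids orienting edges. For a name outside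
  \<open>E\<close> the condition is vacuous, so such names are loops of the matroid and never belong
  to an independent set.\<close>

definition spans :: "'e set \<Rightarrow> 'e \<Rightarrow> bool" where
  "spans A e \<longleftrightarrow> (\<forall>x y. e \<in> E \<longrightarrow> ends e = {x, y} \<longrightarrow> (x, y) \<in> reach A)"

lemma spans_iff:
  assumes "e \<in> E" "ends e = {x, y}"
  shows "spans A e \<longleftrightarrow> (x, y) \<in> reach A"
  using assms reach_sym by (auto simp: spans_def doubleton_eq_iff)

lemma spans_mono: "A \<subseteq> B \<Longrightarrow> spans A e \<Longrightarrow> spans B e"
  using reach_mono unfolding spans_def by blast

text \<open>The number of edges of a spanning forest: vertices minus connected components of the
  graph with edge set A. The truncated subtraction is harmless by
  \<open>card_classes_le\<close>.\<close>

definition rank :: "'e set \<Rightarrow> nat" where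
  "rank A = card V - card (V // reach A)"

lemma card_classes_le:
  assumes "finite S"
  shows "card (S // reach A) \<le> card S"
  using card_image_le[OF assms, of "\<lambda>x. reach A `` {x}"]
  by (simp add: quotient_def UNION_singleton_eq_range)

lemma reach_insert_not_E:
  assumes "e \<notin> E"
  shows "reach (insert e A) = reach A"
  using assms by (simp add: reach_def adj_def)

lemma adj_insert:
  assumes "e \<in> E" "ends e = {u, w}"
  shows "adj (insert e A) = insert (u, w) (insert (w, u) (adj A))"
  using assms by (auto simp: adj_def doubleton_eq_iff)

lemma reach_insert:
  assumes "e \<in> E" "ends e = {u, w}"
  shows "reach (insert e A) = reach A \<union> {(x, y). (x, u) \<in> reach A \<and> (w, y) \<in> reach A}
    \<union> {(x, y). (x, w) \<in> reach A \<and> (u, y) \<in> reach A}"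
  unfolding reach_def adj_insert[OF assms] rtrancl_insert
  by (auto intro: rtrancl_trans)

lemma rank_insert_spanned:
  assumes "spans A e"
  shows "rank (insert e A) = rank A"
proof (cases "e \<in> E")
  case True
  then obtain u w where uw: "ends e = {u, w}" by (rule obtain_ends)
  have "(u, w) \<in> reach A" using assms spans_iff[OF True uw] by simp
  then have "reach (insert e A) = reach A"
    unfolding reach_insert[OF True uw] by (auto, (metis reach_trans reach_sym)+)
  then show ?thesis by (simp add: rank_def)
qed (simp add: rank_def reach_insert_not_E)

text \<open>An unspanned edge merges exactly the two components of its ends. With M the merged class
  and Q the untouched ones, the old classes are the two components and Q, the new ones M and
  Q.\<close>

lemma card_classes_insert:
  assumes "e \<in> E" "\<not> spans A e"
  shows "card (V // reach A) = Suc (card (V // reach (insert e A)))"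
proof -
  obtain u w where uw: "ends e = {u, w}" "u \<noteq> w" "u \<in> V" "w \<in> V"
    by (rule obtain_ends[OF assms(1)])
  have not: "(u, w) \<notin> reach A" using assms spans_iff[OF assms(1) uw(1)] by simp
  define M where "M = reach A `` {u} \<union> reach A `` {w}"
  have cls: "reach (insert e A) `` {x} = (if x \<in> M then M else reach A `` {x})" for x
    unfolding reach_insert[OF assms(1) uw(1)] M_def
    by (auto intro: reach_trans reach_sym)
  have fin: "finite (V // reach A)"
    using finite_V by (simp add: quotient_def)
  have in_M: "x \<in> M \<longleftrightarrow> reach A `` {x} \<in> {reach A `` {u}, reach A `` {w}}" for x
    unfolding M_def insert_iff reach_class_eq_iff using reach_sym by auto
  define Q where "Q = V // reach A - {reach A `` {u}, reach A `` {w}}"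
  have fin_Q: "finite Q" using fin by (simp add: Q_def)
  have "V // reach (insert e A) = insert M Q"
  proof -
    have "V // reach (insert e A) = (\<lambda>x. if x \<in> M then M else reach A `` {x}) ` V"
      unfolding quotient_def cls by auto
    also have "\<dots> = insert M ((\<lambda>x. reach A `` {x}) ` {x\<in>V. x \<notin> M})"
      using uw(3) by (auto simp: M_def)
    also have "(\<lambda>x. reach A `` {x}) ` {x\<in>V. x \<notin> M} = Q"
      unfolding Q_def quotient_def using in_M by auto
    finally show ?thesis .
  qed
  moreover have "M \<notin> Q"
  proof
    assume "M \<in> Q"
    then obtain x where x: "x \<in> V" "M = reach A `` {x}" "M \<noteq> reach A `` {u}"
      by (auto simp: Q_def quotient_def)
    then show False using in_M[of x] x reach_refl[of x A]
      by (metis Image_singleton_iff M_def UnCI insertE not reach_class_eq_iff reach_refl reach_sym singletonD)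
  qed
  moreover have "card (V // reach A) = Suc (Suc (card Q))"
  proof -
    have "V // reach A = insert (reach A `` {u}) (insert (reach A `` {w}) Q)"
      using uw(3,4) by (auto simp: Q_def quotient_def)
    moreover have "reach A `` {u} \<noteq> reach A `` {w}" using not by (simp add: reach_class_eq_iff)
    moreover have "reach A `` {u} \<notin> Q" "reach A `` {w} \<notin> Q" by (auto simp: Q_def)
    ultimately show ?thesis using fin_Q by simp
  qed
  moreover note fin_Q
  ultimately show ?thesis by simp
qed

lemma rank_insert_not_spanned:
  assumes "e \<in> E" "\<not> spans A e"
  shows "rank (insert e A) = Suc (rank A)"
  using card_classes_insert[OF assms] card_classes_le[OF finite_V, of A] by (simp add: rank_def)

sublocale matroid_rank rank
proof
  have inj: "inj_on (\<lambda>x. reach {} `` {x}) V"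
    by (rule inj_onI) (simp add: reach_class_eq_iff, simp add: reach_def adj_def)
  have "V // reach {} = (\<lambda>x. reach {} `` {x}) ` V" by (auto simp: quotient_def)
  then show "rank {} = 0" by (simp add: rank_def card_image[OF inj])
  \<comment> \<open>The rank grows by one exactly at unspanned edges, so the last axiom reduces to
    the monotonicity of \<open>spans\<close>.\<close>
  have *: "rank (insert e A) = (if e \<in> E \<and> \<not> spans A e then Suc (rank A) else rank A)" for A e
    using rank_insert_not_spanned[of e A] rank_insert_spanned[of A e]
    by (auto simp: spans_def)
  show "rank A \<le> rank (insert e A)" "rank (insert e A) \<le> Suc (rank A)" for A e
    unfolding * by auto
  show "rank (insert e B) = rank B" if "A \<subseteq> B" "rank (insert e A) = rank A" for A B e
    using that spans_mono[OF that(1), of e] unfolding * by (auto split: if_splits)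
qed

text \<open>The bridge from rank to cycles. Removing an edge spanned by the rest would leave the
  rank unchanged, impossible in an independent set; conversely, if no edge is spanned by the rest,
  each edge raises the rank when F is built up one by one.\<close>

lemma indep_iff_not_spanned: "indep F \<longleftrightarrow> (\<forall>e\<in>F. \<not> spans (F - {e}) e)"
proof
  assume F: "indep F"
  show "\<forall>e\<in>F. \<not> spans (F - {e}) e"
  proof
    fix e assume e: "e \<in> F"
    have "indep (F - {e})" using indep_subset[OF F] by auto
    then have "rank (insert e (F - {e})) \<noteq> rank (F - {e})"
      using F e by (metis Suc_n_not_n indep_def insert_Diff card.remove finite)
    then show "\<not> spans (F - {e}) e" using rank_insert_spanned by blast
  qed
next
  have "finite F" by simp
  then show "\<forall>e\<in>F. \<not> spans (F - {e}) e \<Longrightarrow> indep F"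
  proof (induction F)
    case empty
    then show ?case by (simp add: indep_def rank_empty)
  next
    case (insert e F)
    have "indep F"
    proof (rule insert.IH, rule ballI)
      fix d assume "d \<in> F"
      then show "\<not> spans (F - {d}) d"
        using insert.prems spans_mono[of "F - {d}" "insert e F - {d}" d] by auto
    qed
    moreover have "\<not> spans F e" using insert.prems insert.hyps by simp
    then have "e \<in> E" by (auto simp: spans_def)
    ultimately show ?case
      using rank_insert_not_spanned[OF _ \<open>\<not> spans F e\<close>] insert.hyps by (simp add: indep_def)
  qed
qed

lemma cycle_spans:
  assumes "is_cycle G vs es"
  shows "\<exists>e\<in>set es. spans (set es - {e}) e"
proof -
  have len: "length es = length vs" "1 \<le> length es" "distinct vs" "distinct es" "set es \<subseteq> E"
    and inc: "\<And>i. i < length es \<Longrightarrow> ends (es ! i) = {vs ! i, vs ! (Suc i mod length es)}"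
    using assms by (auto simp: is_cycle_def)
  obtain n where n: "length es = Suc n" using len(2) by (cases "length es") auto
  \<comment> \<open>Here the index \<open>Suc n mod Suc n\<close> wraps to 0: the last edge closes
    the cycle, and the remaining edges form a path between its ends.\<close>
  have e: "ends (es ! n) = {vs ! n, vs ! 0}" using inc[of n] n by simp
  have "(vs ! 0, vs ! i) \<in> reach (set es - {es ! n})" if "i \<le> n" for i
    using that
  proof (induction i)
    case (Suc i)
    have "es ! i \<in> set es - {es ! n}" "es ! i \<in> E"
      using Suc.prems n len by (auto simp: nth_eq_iff_index_eq)
    moreover have "ends (es ! i) = {vs ! i, vs ! Suc i}"
      using inc[of i] Suc.prems n by simp
    ultimately have "(vs ! i, vs ! Suc i) \<in> reach (set es - {es ! n})"
      by (intro edge_reach)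
    then show ?case using Suc reach_trans by simp
  qed simp
  moreover have "es ! n \<in> E" "es ! n \<in> set es" using n len by auto
  ultimately show ?thesis
    using e spans_iff[of "es ! n" "vs ! 0" "vs ! n"] by (metis insert_commute order_refl)
qed

text \<open>The path is kept simple while a walk is followed: if the next vertex already occurs, the
  path is cut back to that occurrence, otherwise it is prolonged.\<close>

lemma reach_imp_path:
  assumes "(x, y) \<in> reach A"
  shows "\<exists>vs es. length vs = Suc (length es) \<and> distinct vs \<and> vs ! 0 = x \<and> vs ! length es = y \<and>
    set es \<subseteq> A \<inter> E \<and> (\<forall>i<length es. ends (es ! i) = {vs ! i, vs ! Suc i})"
  using assms unfolding reach_def
proof (induction rule: rtrancl_induct)
  case base
  show ?case by (intro exI[of _ "[x]"] exI[of _ "[]"]) auto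
next
  case (step y z)
  then obtain vs es where p: "length vs = Suc (length es)" "distinct vs" "vs ! 0 = x"
    "vs ! length es = y" "set es \<subseteq> A \<inter> E" "\<forall>i<length es. ends (es ! i) = {vs ! i, vs ! Suc i}"
    by blast
  show ?case
  proof (cases "z \<in> set vs")
    case True
    then obtain k where k: "k \<le> length es" "vs ! k = z"
      using p(1) by (metis in_set_conv_nth less_Suc_eq_le)
    have "set (take k es) \<subseteq> A \<inter> E" using p(5) set_take_subset[of k es] by blast
    then show ?thesis
      using p k by (intro exI[of _ "take (Suc k) vs"] exI[of _ "take k es"]) (auto simp: min_def)
  next
    case False
    obtain d where d: "d \<in> A \<inter> E" "ends d = {y, z}" using step.hyps(2) by (auto simp: adj_def)
    have "ends ((es @ [d]) ! i) = {(vs @ [z]) ! i, (vs @ [z]) ! Suc i}" if "i < length (es @ [d])" for i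
      using that p d by (auto simp: nth_append less_Suc_eq)
    then show ?thesis
      using p d False by (intro exI[of _ "vs @ [z]"] exI[of _ "es @ [d]"]) (auto simp: nth_append)
  qed
qed

lemma spanned_imp_cycle:
  assumes "e \<in> E" "e \<in> F" "spans (F - {e}) e"
  shows "\<exists>vs es. is_cycle G vs es \<and> set es \<subseteq> F"
proof -
  obtain u w where uw: "ends e = {u, w}" "u \<noteq> w" by (rule obtain_ends[OF assms(1)])
  obtain vs es where p: "length vs = Suc (length es)" "distinct vs" "vs ! 0 = u"
    "vs ! length es = w" "set es \<subseteq> (F - {e}) \<inter> E"
    "\<forall>i<length es. ends (es ! i) = {vs ! i, vs ! Suc i}"
    using reach_imp_path[of u w "F - {e}"] assms(3) spans_iff[OF assms(1) uw(1)] by auto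
  \<comment> \<open>Since the vertices are distinct, different positions on the path have different
    pairs of ends, hence different edges. The closing edge e is new because the path avoids
    it.\<close>
  have "distinct es"
  proof (unfold distinct_conv_nth, intro allI impI)
    fix i j assume ij: "i < length es" "j < length es" "i \<noteq> j"
    show "es ! i \<noteq> es ! j"
    proof
      assume "es ! i = es ! j"
      then have "{vs ! i, vs ! Suc i} = {vs ! j, vs ! Suc j}" using p(6) ij by metis
      then show False
        using ij p(1,2) by (auto simp: doubleton_eq_iff nth_eq_iff_index_eq)
    qed
  qed
  moreover have "ends ((es @ [e]) ! i) = {vs ! i, vs ! (Suc i mod length (es @ [e]))}"
    if "i < length (es @ [e])" for i
    using that p uw by (cases "i = length es") (auto simp: nth_append)
  ultimately have "is_cycle G vs (es @ [e])"
    unfolding is_cycle_def using p assms by auto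
  then show ?thesis using p(5) assms(2) by (intro exI[of _ vs] exI[of _ "es @ [e]"]) auto
qed

lemma indep_subset_E: "indep F \<Longrightarrow> F \<subseteq> E"
  unfolding indep_iff_not_spanned by (auto simp: spans_def)

theorem is_forest_iff_indep: "is_forest G F \<longleftrightarrow> indep F"
proof
  assume "is_forest G F"
  then show "indep F"
    unfolding indep_iff_not_spanned is_forest_def using spanned_imp_cycle by blast
next
  assume F: "indep F"
  show "is_forest G F"
    unfolding is_forest_def
  proof (intro conjI notI)
    show "F \<subseteq> E" using indep_subset_E[OF F] .
    assume "\<exists>vs es. is_cycle G vs es \<and> set es \<subseteq> F"
    then obtain vs es where "is_cycle G vs es" "set es \<subseteq> F" by blast
    moreover then have "indep (set es)" using indep_subset[OF F] by blast
    ultimately show False using cycle_spans unfolding indep_iff_not_spanned by blast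
  qed
qed

corollary forest_polytope_eq: "forest_polytope G = indep_polytope"
  by (simp add: forest_polytope_def indep_polytope_def is_forest_iff_indep)

end

section \<open>2-connected vertex sets\<close>

lemma not_graph_connected_cut:
  assumes "\<not> graph_connected U D" "U \<noteq> {}"
  obtains W where "W \<subset> U" "W \<noteq> {}" "\<And>x y. x \<in> W \<Longrightarrow> y \<in> U - W \<Longrightarrow> {x, y} \<notin> D"
proof -
  define R where "R = {(x, y). x \<in> U \<and> y \<in> U \<and> {x, y} \<in> D}"
  obtain u v where uv: "u \<in> U" "v \<in> U" "(u, v) \<notin> R\<^sup>*"
    using assms by (auto simp: graph_connected_def R_def)
  define W where "W = {x\<in>U. (u, x) \<in> R\<^sup>*}"
  have "W \<subset> U" using uv by (auto simp: W_def)
  moreover have "W \<noteq> {}" using uv by (auto simp: W_def)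
  moreover have "{x, y} \<notin> D" if "x \<in> W" "y \<in> U - W" for x y
  proof
    assume "{x, y} \<in> D"
    then have "(x, y) \<in> R" using that by (auto simp: R_def W_def)
    then show False using that by (auto simp: W_def intro: rtrancl_into_rtrancl)
  qed
  ultimately show thesis by (rule that)
qed

lemma induced_edges_induced_edges:
  "induced_edges (induced_edges D S) T = induced_edges D (S \<inter> T)"
  by (auto simp: induced_edges_def)

context loopless_graph
begin

definition E_in :: "'v set \<Rightarrow> 'e set" where
  "E_in S = {e \<in> E. ends e \<subseteq> S}"

text \<open>Induced subgraph of the underlying simple graph, with parallel edges collapsed.
  2-connectedness refers to this graph, whereas \<open>E_in\<close> keeps multiplicities.\<close>

definition induced :: "'v set \<Rightarrow> 'v set set" where
  "induced S = induced_edges (ends ` E) S"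

lemma induced_eq: "induced S = ends ` E_in S"
  by (auto simp: induced_def induced_edges_def E_in_def)

lemma E_in_mono: "S \<subseteq> T \<Longrightarrow> E_in S \<subseteq> E_in T"
  by (auto simp: E_in_def)

lemma adj_E_in: "adj (E_in S) = {(x, y). x \<in> S \<and> y \<in> S \<and> {x, y} \<in> induced S}"
  unfolding induced_eq by (auto simp: adj_def E_in_def)

lemma graph_connected_iff_reach:
  "graph_connected S (induced S) \<longleftrightarrow> S \<noteq> {} \<and> (\<forall>u\<in>S. \<forall>v\<in>S. (u, v) \<in> reach (E_in S))"
  by (simp add: graph_connected_def reach_def adj_E_in)

lemma reach_within:
  assumes "(x, y) \<in> reach A" "A \<subseteq> E_in S"
  shows "x = y \<or> x \<in> S \<and> y \<in> S"
  using assms(1) unfolding reach_def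
  by (induction rule: rtrancl_induct) (use assms(2) in \<open>auto simp: adj_def E_in_def subset_iff\<close>)

text \<open>Vertices outside S are isolated for A, so each is a class of its own and cancels in
  vertices minus components.\<close>

lemma rank_within:
  assumes "S \<subseteq> V" "A \<subseteq> E_in S"
  shows "rank A + card (S // reach A) = card S"
proof -
  have fin: "finite S" using assms(1) finite_V finite_subset by blast
  have isolated: "reach A `` {v} = {v}" if "v \<notin> S" for v
    using reach_within[OF _ assms(2)] that by auto
  have "V // reach A = S // reach A \<union> (\<lambda>v. {v}) ` (V - S)"
  proof -
    have "V // reach A = S // reach A \<union> (V - S) // reach A"
      using assms(1) by (auto simp: quotient_def)
    moreover have "(V - S) // reach A = (\<lambda>v. {v}) ` (V - S)"
      using isolated by (auto simp: quotient_def)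
    ultimately show ?thesis by simp
  qed
  moreover have "S // reach A \<inter> (\<lambda>v. {v}) ` (V - S) = {}"
    by (auto simp: quotient_def) (metis Image_singleton_iff reach_refl singletonD)
  moreover have "finite (S // reach A)" using fin by (simp add: quotient_def)
  moreover have "card ((\<lambda>v. {v}) ` (V - S)) = card V - card S"
    using assms(1) fin by (simp add: card_image card_Diff_subset)
  ultimately have "card (V // reach A) = card (S // reach A) + (card V - card S)"
    using finite_V by (simp add: card_Un_disjoint)
  then show ?thesis
    using card_classes_le[OF fin, of A] card_mono[OF finite_V assms(1)] by (simp add: rank_def)
qed

lemma rank_within_less:
  assumes "S \<subseteq> V" "S \<noteq> {}" "A \<subseteq> E_in S"
  shows "Suc (rank A) \<le> card S"
proof -
  have "finite S" using assms(1) finite_V finite_subset by blast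
  then have "finite (S // reach A)" "S // reach A \<noteq> {}"
    using assms(2) by (auto simp: quotient_def)
  then have "card (S // reach A) > 0" by (simp add: card_gt_0_iff)
  then show ?thesis using rank_within[OF assms(1,3)] by simp
qed

lemma rank_connected:
  assumes "S \<subseteq> V" "graph_connected S (induced S)"
  shows "Suc (rank (E_in S)) = card S"
proof -
  obtain s where s: "s \<in> S" using assms(2) by (auto simp: graph_connected_def)
  have "S // reach (E_in S) = {reach (E_in S) `` {s}}"
    using assms(2) s reach_class_eq_iff[of "E_in S" _ s]
    unfolding graph_connected_iff_reach by (auto simp: quotient_def)
  then show ?thesis using rank_within[OF assms(1) order_refl] by simp
qed

abbreviation block :: "'v set \<Rightarrow> bool" where
  "block S \<equiv> S \<subseteq> V \<and> two_connected S (induced S)"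

text \<open>Here x is a candidate point at height t of the cone, known only to satisfy the
  inequalities of the blocks. The aim is the inequality for every edge set.\<close>

context
  fixes x :: "'e \<Rightarrow> real" and t :: real
  assumes nonneg: "\<And>e. 0 \<le> x e" "0 \<le> t"
    and block_bound: "\<And>S. block S \<Longrightarrow> sum x (E_in S) \<le> t * (real (card S) - 1)"
begin

text \<open>A vertex set that is not 2-connected is split at a cut: into two parts without common vertices
  if it is disconnected, and otherwise into two parts sharing one cut vertex.\<close>

lemma vertex_set_bound:
  assumes "S \<subseteq> V" "S \<noteq> {}"
  shows "sum x (E_in S) \<le> t * (real (card S) - 1)"
  using assms
proof (induction "card S" arbitrary: S rule: less_induct)
  case less
  have fin: "finite S" using less.prems finite_V finite_subset by blast
  \<comment> \<open>If A and B share one cut vertex, then |A| + |B| = |S| + 1 and this is exactly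
    the bound sought; if they partition S, it is stronger by t.\<close>
  have split: "sum x (E_in S) \<le> t * (real (card A) + real (card B) - 2)"
    if "A \<subset> S" "B \<subset> S" "A \<noteq> {}" "B \<noteq> {}" "E_in S \<subseteq> E_in A \<union> E_in B" for A B
  proof -
    have "sum x (E_in S) \<le> sum x (E_in A \<union> E_in B)"
      using that nonneg by (intro sum_mono2) auto
    also have "\<dots> \<le> sum x (E_in A) + sum x (E_in B)"
      using nonneg sum_nonneg[of "E_in A \<inter> E_in B" x] by (simp add: sum_Un)
    also have "\<dots> \<le> t * (real (card A) - 1) + t * (real (card B) - 1)"
      using that less.prems fin by (intro add_mono less.hyps psubset_card_mono) auto
    finally show ?thesis by (simp add: algebra_simps)
  qed
  \<comment> \<open>A single vertex fails to be 2-connected only for its size and offers no cut, so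
    it is kept apart; it spans no edge because there are no loops.\<close>
  consider "card S = 1" | "block S" | "\<not> graph_connected S (induced S)"
    | v where "v \<in> S" "card S \<noteq> 1" "\<not> graph_connected (S - {v}) (induced (S - {v}))"
  proof -
    have "(S \<inter> (S - {v})) = S - {v}" for v by auto
    moreover have "card S \<noteq> 0" using less.prems fin by simp
    ultimately show thesis
      using that less.prems
      unfolding two_connected_def induced_def induced_edges_induced_edges by force
  qed
  then show ?case
  proof cases
    case 1
    then obtain v where v: "S = {v}" by (auto simp: card_1_singleton_iff)
    have "e \<notin> E_in S" for e
    proof
      assume "e \<in> E_in S"
      then have "e \<in> E" "ends e \<subseteq> {v}" by (auto simp: E_in_def v)
      then show False using card_ends[of e] card_mono[of "{v}" "ends e"] by simp
    qed
    then have "E_in S = {}" by blast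
    then show ?thesis using 1 by simp
  next
    case 2
    then show ?thesis by (intro block_bound) auto
  next
    case 3
    then obtain W where W: "W \<subset> S" "W \<noteq> {}"
      "\<And>x y. x \<in> W \<Longrightarrow> y \<in> S - W \<Longrightarrow> {x, y} \<notin> induced S"
      using not_graph_connected_cut less.prems by metis
    have "E_in S \<subseteq> E_in W \<union> E_in (S - W)"
    proof
      fix e assume e: "e \<in> E_in S"
      then obtain a b where ab: "ends e = {a, b}" by (auto simp: E_in_def elim: obtain_ends)
      moreover have "{a, b} \<in> induced S" "{b, a} \<in> induced S"
        using e ab by (auto simp: induced_eq insert_commute)
      ultimately show "e \<in> E_in W \<union> E_in (S - W)"
        using W(3)[of a b] W(3)[of b a] e by (auto simp: E_in_def)
    qed
    then have "sum x (E_in S) \<le> t * (real (card W) + real (card (S - W)) - 2)"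
      using W by (intro split) auto
    also have "\<dots> \<le> t * (real (card S) - 1)"
    proof (rule mult_left_mono[OF _ nonneg(2)])
      have "card S = card W + card (S - W)"
        using W(1) fin by (metis card_Un_disjoint Diff_disjoint Diff_partition finite_subset
            finite_Diff psubset_imp_subset)
      then show "real (card W) + real (card (S - W)) - 2 \<le> real (card S) - 1" by simp
    qed
    finally show ?thesis .
  next
    case 4
    have "S - {v} \<noteq> {}" using 4(1,2) fin by (metis card_1_singleton_iff One_nat_def insert_Diff)
    then obtain W where W: "W \<subset> S - {v}" "W \<noteq> {}"
      "\<And>x y. x \<in> W \<Longrightarrow> y \<in> S - {v} - W \<Longrightarrow> {x, y} \<notin> induced (S - {v})"
      using not_graph_connected_cut[OF 4(3)] by metis
    \<comment> \<open>Both parts contain v. An edge at v follows its other end, and an edge avoiding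
      v cannot cross from W to the rest.\<close>
    have "E_in S \<subseteq> E_in (insert v W) \<union> E_in (S - W)"
    proof
      fix e assume e: "e \<in> E_in S"
      then obtain a b where ab: "ends e = {a, b}" by (auto simp: E_in_def elim: obtain_ends)
      have "{a, b} \<in> induced (S - {v}) \<and> {b, a} \<in> induced (S - {v})" if "a \<noteq> v" "b \<noteq> v"
        using e ab that by (auto simp: induced_eq insert_commute E_in_def intro!: image_eqI[of _ _ e])
      then show "e \<in> E_in (insert v W) \<union> E_in (S - W)"
        using W(1) W(3)[of a b] W(3)[of b a] e ab 4(1) by (auto simp: E_in_def)
    qed
    then have "sum x (E_in S) \<le> t * (real (card (insert v W)) + real (card (S - W)) - 2)"
      using W 4(1) by (intro split) auto
    also have "\<dots> = t * (real (card S) - 1)"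
    proof -
      have "card S = card W + card (S - W)"
        using W(1) fin by (metis card_Un_disjoint Diff_disjoint Diff_partition finite_subset
            finite_Diff psubset_imp_subset Diff_subset subset_trans)
      moreover have "v \<notin> W" "finite W" using W(1) fin finite_subset by blast+
      ultimately show ?thesis by simp
    qed
    finally show ?thesis .
  qed
qed

text \<open>The edges of A lie inside the components of A, and |C| - 1 summed over all components C
  is |V| minus their number, which is the rank of A. Isolated vertices contribute 0.\<close>

lemma rank_bound: "sum x (A \<inter> E) \<le> t * real (rank A)"
proof -
  define Q where "Q = V // reach A"
  have fin: "finite Q" using finite_V by (simp add: Q_def quotient_def)
  have sub: "C \<subseteq> V" "C \<noteq> {}" if C: "C \<in> Q" for C
  proof -
    obtain v where v: "v \<in> V" "C = reach A `` {v}" using C by (auto simp: Q_def quotient_def)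
    have "A \<inter> E \<subseteq> E_in V" using ends_subset by (auto simp: E_in_def)
    moreover have "reach A = reach (A \<inter> E)" by (simp add: reach_def adj_def)
    ultimately show "C \<subseteq> V" "C \<noteq> {}"
      using reach_within[of _ _ "A \<inter> E" V] v reach_refl[of v "A \<inter> E"] by blast+
  qed
  have disj: "C \<inter> D = {}" if "C \<in> Q" "D \<in> Q" "C \<noteq> D" for C D
    using that quotient_disj[OF equiv_reach, of C A D] by (auto simp: Q_def quotient_def)
  have "A \<inter> E \<subseteq> (\<Union>C\<in>Q. E_in C)"
  proof
    fix e assume e: "e \<in> A \<inter> E"
    then obtain u w where uw: "ends e = {u, w}" "u \<in> V" by (auto elim: obtain_ends)
    have "ends e \<subseteq> reach A `` {u}" using edge_reach[of e A u w] e uw by auto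
    then show "e \<in> (\<Union>C\<in>Q. E_in C)"
      using e uw by (auto simp: Q_def quotient_def E_in_def intro!: bexI[of _ u])
  qed
  then have "sum x (A \<inter> E) \<le> sum x (\<Union>C\<in>Q. E_in C)"
    using nonneg by (intro sum_mono2) auto
  also have "\<dots> = (\<Sum>C\<in>Q. sum x (E_in C))"
  proof (rule sum.UNION_disjoint[OF fin])
    show "\<forall>C\<in>Q. \<forall>D\<in>Q. C \<noteq> D \<longrightarrow> E_in C \<inter> E_in D = {}"
    proof (intro ballI impI)
      fix C D assume "C \<in> Q" "D \<in> Q" "C \<noteq> D"
      then have "C \<inter> D = {}" by (rule disj)
      then show "E_in C \<inter> E_in D = {}"
        by (auto simp: E_in_def elim!: obtain_ends)
    qed
  qed simp
  also have "\<dots> \<le> (\<Sum>C\<in>Q. t * (real (card C) - 1))"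
    by (intro sum_mono vertex_set_bound sub)
  also have "\<dots> = t * (real (\<Sum>C\<in>Q. card C) - real (card Q))"
    by (simp add: sum_subtractf flip: sum_distrib_left)
  also have "(\<Sum>C\<in>Q. card C) = card (\<Union>Q)"
  proof (rule card_Union_disjoint[symmetric])
    show "pairwise disjnt Q" using disj by (intro pairwiseI) (simp add: disjnt_def)
    show "finite C" if "C \<in> Q" for C using sub(1)[OF that] finite_V by (rule finite_subset)
  qed
  also have "\<Union>Q = V"
  proof
    show "\<Union>Q \<subseteq> V" using sub(1) by blast
    show "V \<subseteq> \<Union>Q"
    proof
      fix v assume "v \<in> V"
      then have "reach A `` {v} \<in> Q" unfolding Q_def by (rule quotientI)
      then show "v \<in> \<Union>Q" by (rule UnionI) simp
    qed
  qed
  also have "real (card V) - real (card Q) = real (rank A)"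
    using card_classes_le[OF finite_V, of A] by (simp add: rank_def Q_def)
  finally show ?thesis .
qed

end

section \<open>Inequalities of the cone over the forest polytope\<close>

lemma zero_in_indep_polytope: "0 \<in> indep_polytope"
  by (simp add: indep_polytope_eq)

theorem polytope_cone_iff:
  "(x, t) \<in> polytope_cone indep_polytope \<longleftrightarrow>
    0 \<le> t \<and> (\<forall>e. 0 \<le> x $ e) \<and> (\<forall>e. e \<notin> E \<longrightarrow> x $ e = 0) \<and>
    (\<forall>S. block S \<longrightarrow> (\<Sum>e\<in>E_in S. x $ e) \<le> t * (real (card S) - 1))" (is "_ \<longleftrightarrow> ?R")
proof
  assume "(x, t) \<in> polytope_cone indep_polytope"
  then obtain y where y: "y \<in> indep_polytope" "x = t *\<^sub>R y" "0 \<le> t"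
    by (auto simp: polytope_cone_def conic_hull_explicit)
  have nn: "0 \<le> y $ e" and bd: "(\<Sum>e\<in>A. y $ e) \<le> rank A" for e A
    using y(1) by (auto simp: indep_polytope_eq)
  have "y $ e = 0" if "e \<notin> E" for e
  proof -
    have "rank {e} = 0" using rank_insert_spanned[of "{}" e] that by (simp add: spans_def rank_empty)
    then show ?thesis using nn[of e] bd[of "{e}"] by simp
  qed
  moreover have "(\<Sum>e\<in>E_in S. x $ e) \<le> t * (real (card S) - 1)" if "block S" for S
  proof -
    have "S \<noteq> {}" using that by (auto simp: two_connected_def)
    then have "(\<Sum>e\<in>E_in S. y $ e) \<le> real (card S) - 1"
      using bd[of "E_in S"] rank_within_less[of S "E_in S"] that by auto
    then show ?thesis using y by (simp add: mult_left_mono flip: sum_distrib_left)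
  qed
  ultimately show ?R using y nn by auto
next
  assume R: ?R
  have bd: "(\<Sum>e\<in>A. x $ e) \<le> t * real (rank A)" for A
  proof -
    have "(\<Sum>e\<in>A. x $ e) = (\<Sum>e\<in>A \<inter> E. x $ e)"
      using R by (intro sum.mono_neutral_right) auto
    also have "\<dots> \<le> t * real (rank A)"
      using R by (intro rank_bound) auto
    finally show ?thesis .
  qed
  show "(x, t) \<in> polytope_cone indep_polytope"
  \<comment> \<open>At height 0 the rank bounds force x = 0, so only the apex remains; at positive
    height one rescales to height 1.\<close>
  proof (cases "t = 0")
    case True
    have "x $ e = 0" for e using bd[of "{e}"] R True by (auto intro: antisym)
    then have "(x, t) = 0 *\<^sub>R (0, 1)" using True by (simp add: vec_eq_iff)
    then show ?thesis
      unfolding polytope_cone_def conic_hull_explicit using zero_in_indep_polytope by blast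
  next
    case False
    then have t: "t > 0" using R by simp
    have "x /\<^sub>R t \<in> indep_polytope"
      using R t bd by (auto simp: indep_polytope_eq divide_inverse_commute[symmetric] pos_divide_le_eq
          mult.commute simp flip: sum_divide_distrib)
    moreover have "(x, t) = t *\<^sub>R (x /\<^sub>R t, 1)" using t by simp
    ultimately show ?thesis
      unfolding polytope_cone_def conic_hull_explicit using t less_imp_le by blast
  qed
qed

end

section \<open>Facets of polyhedral cones\<close>

lemma face_of_nonneg_form:
  fixes h :: "'a::real_vector \<Rightarrow> real"
  assumes h: "linear h" "\<And>z. z \<in> C \<Longrightarrow> 0 \<le> h z" and C: "convex C"
  shows "{z \<in> C. h z = 0} face_of C"
proof -
  note lin = linear_add[OF h(1)] linear_scale[OF h(1)]
  have "a \<in> {z \<in> C. h z = 0} \<and> b \<in> {z \<in> C. h z = 0}"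
    if *: "a \<in> C" "b \<in> C" "x \<in> {z \<in> C. h z = 0}" "x \<in> open_segment a b" for a b x
  proof -
    obtain u where u: "0 < u" "u < 1" "x = (1 - u) *\<^sub>R a + u *\<^sub>R b"
      using *(4) by (auto simp: in_segment)
    have "(1 - u) * h a + u * h b = 0" using *(3) u(3) by (simp add: lin)
    moreover have "0 \<le> (1 - u) * h a" "0 \<le> u * h b" using u h(2) * by auto
    ultimately have "(1 - u) * h a = 0" "u * h b = 0" by linarith+
    then show ?thesis using u * by simp
  qed
  moreover have "convex {z \<in> C. h z = 0}"
    using C by (auto simp: convex_def lin)
  ultimately show ?thesis unfolding face_of_def by blast
qed

text \<open>One point w off the face that together with the face spans C makes the dimension drop by
  exactly one: 0 lies on the face, so spans and affine hulls agree, and w is outside the hull of the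
  face because h vanishes there.\<close>

lemma facet_of_nonneg_form:
  fixes h :: "'a::euclidean_space \<Rightarrow> real"
  assumes h: "linear h" "\<And>z. z \<in> C \<Longrightarrow> 0 \<le> h z" and C: "convex C" "0 \<in> C"
    and w: "w \<in> C" "h w \<noteq> 0" "C \<subseteq> span (insert w {z \<in> C. h z = 0})"
  shows "{z \<in> C. h z = 0} facet_of C"
proof -
  define F where "F = {z \<in> C. h z = 0}"
  have F0: "0 \<in> F" using C(2) linear_0[OF h(1)] by (simp add: F_def)
  have "affine hull F \<subseteq> {z. h z = 0}"
  proof -
    have "span F \<subseteq> {z. h z = 0}"
      by (intro span_minimal linear_subspace_kernel h(1)) (auto simp: F_def)
    then show ?thesis using affine_hull_subset_span[of F] by blast
  qed
  then have w_notin: "w \<notin> affine hull F" using w(2) by auto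
  have "aff_dim C = aff_dim (insert w F)"
  proof (rule antisym)
    have "span (insert w F) = affine hull (insert w F)"
      using F0 by (intro affine_hull_span_0[symmetric] hull_inc) auto
    then show "aff_dim C \<le> aff_dim (insert w F)"
      using aff_dim_subset[OF w(3)[folded F_def]] by simp
    show "aff_dim (insert w F) \<le> aff_dim C"
      using w(1) by (intro aff_dim_subset) (auto simp: F_def)
  qed
  then have "aff_dim F = aff_dim C - 1" using w_notin by (simp add: aff_dim_insert)
  then show ?thesis
    unfolding facet_of_def using face_of_nonneg_form[OF h C(1)] F0 by (auto simp: F_def)
qed

text \<open>If no form of J vanished on all of F, averaging would give a point z of F where all are
  positive. Such a z is relatively interior to C, so F would be C. Hence some h vanishes on F; its
  zero set in C is a proper face containing F, and comparing dimensions makes them equal.\<close>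

lemma facet_given_by_inequality:
  fixes C :: "'a::euclidean_space set" and J :: "('a \<Rightarrow> real) set"
  assumes C: "C = {z \<in> L. \<forall>h\<in>J. 0 \<le> h z}" "subspace L"
    and J: "finite J" "\<And>h. h \<in> J \<Longrightarrow> linear h" "\<And>h. h \<in> J \<Longrightarrow> \<exists>p\<in>C. 0 < h p"
    and F: "F facet_of C"
  shows "\<exists>h\<in>J. F = {z \<in> C. h z = 0}"
proof -
  have face: "F face_of C" "F \<noteq> {}" "aff_dim F = aff_dim C - 1"
    using F by (auto simp: facet_of_def)
  have FC: "F \<subseteq> C" "convex F" using face(1) by (auto simp: face_of_def)
  have C_convex: "convex C"
  proof (rule convexI)
    fix a b :: 'a and u v :: real
    assume ab: "a \<in> C" "b \<in> C" and uv: "0 \<le> u" "0 \<le> v" "u + v = 1"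
    have "u *\<^sub>R a + v *\<^sub>R b \<in> L"
      using ab C by (auto intro!: subspace_add subspace_scale)
    moreover have "0 \<le> h (u *\<^sub>R a + v *\<^sub>R b)" if "h \<in> J" for h
    proof -
      have "h (u *\<^sub>R a + v *\<^sub>R b) = u * h a + v * h b"
        using J(2)[OF that] by (simp add: linear_add linear_scale)
      moreover have "0 \<le> h a" "0 \<le> h b" using ab that unfolding C(1) by auto
      ultimately show ?thesis using uv by simp
    qed
    ultimately show "u *\<^sub>R a + v *\<^sub>R b \<in> C" unfolding C(1) by blast
  qed
  have "\<exists>h\<in>J. \<forall>z\<in>F. h z = 0"
  proof (rule ccontr)
    assume neg: "\<not> ?thesis"
    have not0: "\<exists>z\<in>F. 0 < h z" if h: "h \<in> J" for h
    proof -
      obtain z where z: "z \<in> F" "h z \<noteq> 0" using neg h by blast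
      then have "0 \<le> h z" using FC(1) h unfolding C(1) by blast
      then show ?thesis using z by (intro bexI[of _ z]) auto
    qed
    have "\<exists>z\<in>F. \<forall>h\<in>I. 0 < h z" if "finite I" "I \<subseteq> J" for I
      using that
    proof (induction I)
      case empty
      then show ?case using face(2) by auto
    next
      case (insert h I)
      then obtain z z' where z: "z \<in> F" "\<forall>h\<in>I. 0 < h z" "z' \<in> F" "0 < h z'"
        using not0[of h] by auto
      have "(1/2) *\<^sub>R z + (1/2) *\<^sub>R z' \<in> F" using z FC(2) by (intro convexD) auto
      moreover have "0 < g ((1/2) *\<^sub>R z + (1/2) *\<^sub>R z')" if "g \<in> insert h I" for g
      proof -
        have "g \<in> J" using that insert.prems by auto
        then have "0 \<le> g z" "0 \<le> g z'" "linear g" using z FC(1) C(1) J(2) by auto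
        moreover have "0 < g z \<or> 0 < g z'" using that z by auto
        ultimately show ?thesis by (auto simp: linear_add linear_scale)
      qed
      ultimately show ?case by blast
    qed
    then obtain z where z: "z \<in> F" "\<forall>h\<in>J. 0 < h z" using J(1) by blast
    have "w \<in> F" if w: "w \<in> C" for w
    proof (cases "w = z")
      case False
      \<comment> \<open>The aim is to prolong the segment from w to z beyond z, to z + \<epsilon> (z
        - w), without leaving C.\<close>
      have "\<exists>\<epsilon>>0. \<forall>h\<in>I. \<epsilon> * h w \<le> h z" if "finite I" "I \<subseteq> J" for I
        using that
      proof (induction I)
        case empty
        then show ?case by (intro exI[of _ 1]) auto
      next
        case (insert h I)
        then obtain \<epsilon> where \<epsilon>: "\<epsilon> > 0" "\<forall>h\<in>I. \<epsilon> * h w \<le> h z" by auto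
        \<comment> \<open>The denominator is \<open>h w + 1\<close> because \<open>h w\<close> may
          be 0.\<close>
        define \<eta> where "\<eta> = min \<epsilon> (h z / (h w + 1))"
        have pos: "0 \<le> g w" "0 < g z" if "g \<in> insert h I" for g
          using that insert.prems w z C(1) by auto
        have "\<eta> * h w \<le> h z"
        proof -
          have "\<eta> * h w \<le> h z / (h w + 1) * h w"
            using pos[of h] by (intro mult_right_mono) (auto simp: \<eta>_def)
          also have "\<dots> \<le> h z" using pos[of h] by (simp add: field_simps)
          finally show ?thesis .
        qed
        moreover have "\<eta> * g w \<le> g z" if "g \<in> I" for g
        proof -
          have "\<eta> * g w \<le> \<epsilon> * g w" using pos[of g] that by (intro mult_right_mono) (auto simp: \<eta>_def)
          then show ?thesis using \<epsilon> that by fastforce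
        qed
        moreover have "\<eta> > 0" using pos[of h] \<epsilon> by (simp add: \<eta>_def)
        ultimately show ?case by auto
      qed
      then obtain \<epsilon> where \<epsilon>: "\<epsilon> > 0" "\<forall>h\<in>J. \<epsilon> * h w \<le> h z" using J(1) by blast
      define y where "y = (1 + \<epsilon>) *\<^sub>R z - \<epsilon> *\<^sub>R w"
      have hy: "h y = h z + (\<epsilon> * h z - \<epsilon> * h w)" if "h \<in> J" for h
        unfolding y_def linear_diff[OF J(2)[OF that]] linear_scale[OF J(2)[OF that]]
        by (simp add: algebra_simps)
      have "0 \<le> h y" if "h \<in> J" for h
      proof -
        have "0 \<le> \<epsilon> * h z" "\<epsilon> * h w \<le> h z" using that \<epsilon> z(2) by auto
        then show ?thesis using hy[OF that] by linarith
      qed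
      moreover have "y \<in> L"
        using z(1) FC(1) w C unfolding y_def by (auto intro!: subspace_diff subspace_scale)
      ultimately have "y \<in> C" by (simp add: C(1))
      moreover have "z \<in> open_segment y w"
      proof -
        have "z = (1 - \<epsilon> / (1 + \<epsilon>)) *\<^sub>R y + (\<epsilon> / (1 + \<epsilon>)) *\<^sub>R w"
        proof -
          have "(1 + \<epsilon>) *\<^sub>R z = y + \<epsilon> *\<^sub>R w" by (simp add: y_def)
          then have "(1 / (1 + \<epsilon>)) *\<^sub>R (1 + \<epsilon>) *\<^sub>R z = (1 / (1 + \<epsilon>)) *\<^sub>R (y + \<epsilon> *\<^sub>R w)"
            by (rule arg_cong)
          moreover have "1 - \<epsilon> / (1 + \<epsilon>) = 1 / (1 + \<epsilon>)" using \<epsilon>(1) by (simp add: field_simps)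
          ultimately show ?thesis using \<epsilon>(1) by (simp add: scaleR_add_right)
        qed
        moreover have "y \<noteq> w"
        proof
          assume "y = w"
          then have "(1 + \<epsilon>) *\<^sub>R z = (1 + \<epsilon>) *\<^sub>R w"
            by (simp add: y_def scaleR_add_left diff_eq_eq)
          then show False using \<epsilon>(1) False by simp
        qed
        moreover have "0 < \<epsilon> / (1 + \<epsilon>)" "\<epsilon> / (1 + \<epsilon>) < 1" using \<epsilon>(1) by auto
        ultimately show ?thesis by (auto simp: in_segment)
      qed
      ultimately show ?thesis using face_ofD[OF face(1), of z y w] w z(1) by blast
    qed (use z in simp)
    then have "F = C" using FC by auto
    then have "aff_dim C = aff_dim C - 1" using face(3) by simp
    then show False by simp
  qed
  then obtain h where h: "h \<in> J" "\<forall>z\<in>F. h z = 0" by blast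
  define F' where "F' = {z \<in> C. h z = 0}"
  have F': "F' face_of C"
    unfolding F'_def using C(1) h(1) J(2) C_convex by (intro face_of_nonneg_form) auto
  have "F \<subseteq> F'" using h FC by (auto simp: F'_def)
  obtain p where "p \<in> C" "0 < h p" using J(3)[OF h(1)] by blast
  then have "p \<notin> F'" by (simp add: F'_def)
  with \<open>p \<in> C\<close> have "F' \<noteq> C" by blast
  then have "aff_dim F' < aff_dim C" using F' C_convex by (intro face_of_aff_dim_lt) auto
  moreover have "aff_dim F < aff_dim F'" if "F \<noteq> F'"
    using that F' face_of_subset[OF face(1) \<open>F \<subseteq> F'\<close>]
    by (intro face_of_aff_dim_lt) (auto simp: face_of_def)
  ultimately have "F = F'" using face(3) by fastforce
  then show ?thesis using h(1) by (auto simp: F'_def)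
qed

section \<open>Spanned lattice and reduced equations of a cone over a polytope\<close>

lemma cone_point: "x \<in> P \<Longrightarrow> (x, 1) \<in> polytope_cone P"
  unfolding polytope_cone_def by (intro hull_inc) auto

lemma polytope_cone_iff_dilate:
  "(x, t) \<in> polytope_cone P \<longleftrightarrow> 0 \<le> t \<and> x \<in> (*\<^sub>R) t ` P"
  by (auto simp: polytope_cone_def conic_hull_explicit)

lemma convex_polytope_cone: "convex P \<Longrightarrow> convex (polytope_cone P)"
  unfolding polytope_cone_def by (intro convex_conic_hull convex_Times) auto

lemma lattice_point_in_spanned_lattice:
  assumes "x \<in> lattice_points P"
  shows "(x, 1) \<in> spanned_lattice P"
  unfolding spanned_lattice_def
  using assms by (intro CollectI exI[of _ "{x}"] exI[of _ "\<lambda>_. 1"]) auto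

lemma spanned_lattice_subset_span:
  fixes P :: "(real ^ 'n) set"
  shows "spanned_lattice P \<subseteq> span (polytope_cone P)"
proof
  fix z assume "z \<in> spanned_lattice P"
  then obtain X and c :: "real ^ 'n \<Rightarrow> int" where X: "X \<subseteq> lattice_points P"
    and z: "z = (\<Sum>x\<in>X. of_int (c x) *\<^sub>R (x, 1))"
    unfolding spanned_lattice_def by blast
  show "z \<in> span (polytope_cone P)"
    unfolding z using X
    by (intro span_sum span_scale span_base cone_point) (auto simp: lattice_points_def)
qed

lemma spanned_lattice_form_Ints:
  fixes h :: "(real ^ 'n) \<times> real \<Rightarrow> real"
  assumes "linear h" "\<And>x. x \<in> lattice_points P \<Longrightarrow> h (x, 1) \<in> \<int>" "z \<in> spanned_lattice P"
  shows "h z \<in> \<int>"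
proof -
  obtain X and c :: "real ^ 'n \<Rightarrow> int" where "X \<subseteq> lattice_points P"
    and z: "z = (\<Sum>x\<in>X. of_int (c x) *\<^sub>R (x, 1))"
    using assms(3) unfolding spanned_lattice_def by blast
  then show ?thesis
    using assms(1,2) by (auto simp: linear_sum linear_scale simp del: scaleR_Pair intro!: Ints_sum Ints_mult)
qed

text \<open>Both forms vanish on the face, so h = c g on the span of the cone with c > 0, the ratio
  being read off at w. Since g differs by 1 between the lattice points a and b, c is an integer; as
  h / c = g is integral on the lattice, primitivity of h gives c = 1.\<close>

lemma reduced_equation_unique:
  assumes h: "reduced_equation P {z \<in> polytope_cone P. g z = 0} h"
    and g: "linear g" "\<And>z. z \<in> polytope_cone P \<Longrightarrow> 0 \<le> g z"
      "\<And>z. z \<in> spanned_lattice P \<Longrightarrow> g z \<in> \<int>"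
    and w: "w \<in> polytope_cone P" "g w \<noteq> 0"
      "polytope_cone P \<subseteq> span (insert w {z \<in> polytope_cone P. g z = 0})"
    and ab: "a \<in> spanned_lattice P" "b \<in> spanned_lattice P" "g a - g b = 1"
    and z: "z \<in> spanned_lattice P"
  shows "h z = g z"
proof -
  define F where "F = {z \<in> polytope_cone P. g z = 0}"
  define c where "c = h w / g w"
  have h: "linear h" "\<And>z. z \<in> polytope_cone P \<Longrightarrow> 0 \<le> h z" "F = {z \<in> polytope_cone P. h z = 0}"
    "\<And>z. z \<in> spanned_lattice P \<Longrightarrow> h z \<in> \<int>"
    "\<not> (\<exists>k::nat. 2 \<le> k \<and> (\<forall>z\<in>spanned_lattice P. h z / real k \<in> \<int>))"
    using h unfolding reduced_equation_def F_def by auto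
  have lin: "linear (\<lambda>z. h z - c * g z)"
    by (rule linearI) (simp_all add: linear_add[OF h(1)] linear_add[OF g(1)]
        linear_scale[OF h(1)] linear_scale[OF g(1)] algebra_simps)
  have "span (insert w F) \<subseteq> {z. h z - c * g z = 0}"
  proof (rule span_minimal[OF _ linear_subspace_kernel[OF lin]])
    have "h z = 0" "g z = 0" if "z \<in> F" for z
      using that h(3) F_def by blast+
    then show "insert w F \<subseteq> {z. h z - c * g z = 0}"
      using w(2) by (auto simp: c_def)
  qed
  moreover have "span (polytope_cone P) \<subseteq> span (insert w F)"
    using w(3) by (intro span_minimal subspace_span) (simp add: F_def)
  ultimately have eq: "h z = c * g z" if "z \<in> spanned_lattice P" for z
    using subsetD[OF spanned_lattice_subset_span that] by auto
  have "h a - h b = c * (g a - g b)"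
    unfolding eq[OF ab(1)] eq[OF ab(2)] by (rule right_diff_distrib[symmetric])
  then have "h a - h b = c" unfolding ab(3) by simp
  then have "c \<in> \<int>" using h(4) ab(1,2) by (metis Ints_diff)
  moreover have "c > 0"
  proof -
    have "w \<notin> F" using w(2) by (simp add: F_def)
    then have "h w \<noteq> 0" unfolding h(3) using w(1) by simp
    then have "h w > 0" using h(2)[OF w(1)] by linarith
    moreover have "g w > 0" using g(2)[OF w(1)] w(2) by simp
    ultimately show ?thesis by (simp add: c_def)
  qed
  ultimately obtain n :: int where n: "c = of_int n" "n > 0" by (auto elim!: Ints_cases)
  have "n < 2"
  proof (rule ccontr)
    assume "\<not> n < 2"
    then have "2 \<le> nat n" by simp
    moreover have "h z / real (nat n) \<in> \<int>" if "z \<in> spanned_lattice P" for z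
      using g(3)[OF that] eq[OF that] n by simp
    ultimately show False using h(5) by blast
  qed
  then have "c = 1" using n by simp
  then show ?thesis using eq[OF z] by simp
qed

text \<open>The value 1 at v does double duty: it makes each form of J primitive, and it shows that
  the form is positive somewhere on the cone, as \<open>facet_given_by_inequality\<close>
  requires.\<close>

lemma delta_gorensteinI:
  fixes P :: "(real ^ 'n) set" and J :: "((real ^ 'n) \<times> real \<Rightarrow> real) set"
  assumes C: "polytope_cone P = {z \<in> L. \<forall>h\<in>J. 0 \<le> h z}" "subspace L"
    and J: "finite J" "\<And>h. h \<in> J \<Longrightarrow> linear h"
      "\<And>h z. h \<in> J \<Longrightarrow> z \<in> spanned_lattice P \<Longrightarrow> h z \<in> \<int>"
    and v: "v \<in> dilate_lattice_points \<delta> P" "\<And>h. h \<in> J \<Longrightarrow> h (v, real \<delta>) = 1"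
  shows "delta_gorenstein \<delta> P"
  unfolding delta_gorenstein_def
proof (intro bexI[OF _ v(1)] allI impI)
  have v': "(v, real \<delta>) \<in> polytope_cone P" "(v, real \<delta>) \<in> spanned_lattice P"
    using v(1) by (auto simp: dilate_lattice_points_def polytope_cone_iff_dilate)
  have cone_nonneg: "0 \<le> h z" if "h \<in> J" "z \<in> polytope_cone P" for h z
    using that unfolding C(1) by blast
  fix F assume "F facet_of polytope_cone P"
  moreover have "\<exists>p\<in>polytope_cone P. 0 < h p" if "h \<in> J" for h
    using v(2)[OF that] v'(1) by (intro bexI) auto
  ultimately obtain h where h: "h \<in> J" "F = {z \<in> polytope_cone P. h z = 0}"
    using facet_given_by_inequality[OF C J(1,2)] by blast
  have "\<not> (\<forall>z\<in>spanned_lattice P. h z / real k \<in> \<int>)" if "2 \<le> k" for k :: nat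
  proof
    assume "\<forall>z\<in>spanned_lattice P. h z / real k \<in> \<int>"
    then have "1 / real k \<in> \<int>" using v'(2) v(2)[OF h(1)] by metis
    then obtain n where n: "1 / real k = of_int n" by (rule Ints_cases)
    moreover have "0 < 1 / real k" "1 / real k < 1" using that by auto
    ultimately have "0 < n" "n < 1" by simp_all
    then show False by simp
  qed
  then have "reduced_equation P F h"
    unfolding reduced_equation_def using h J(2,3)[OF h(1)] cone_nonneg by blast
  then show "\<exists>h. reduced_equation P F h \<and> h (v, real \<delta>) = 1" using v(2)[OF h(1)] by blast
qed

section \<open>Facets of the forest polytope\<close>

lemma ind_vec_sum: "ind_vec F = (\<Sum>e\<in>F. ind_vec {e})"
  by (simp add: vec_eq_iff indicator_def)

lemma ind_vec_insert: "e \<notin> F \<Longrightarrow> ind_vec (insert e F) = ind_vec {e} + ind_vec F"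
  by (auto simp: vec_eq_iff indicator_def)

lemma vec_lambda_zero: "(\<chi> e. 0) = 0"
  by (simp add: vec_eq_iff)

lemma ind_vec_singleton_inject: "ind_vec {e} = ind_vec {d} \<longleftrightarrow> e = d"
  by (metis (no_types, lifting) indicator_eq_0_iff indicator_eq_1_iff singleton_iff vec_lambda_beta zero_neq_one)

context loopless_graph
begin

abbreviation P :: "(real ^ 'e) set" where
  "P \<equiv> indep_polytope"

definition coord :: "'e \<Rightarrow> (real ^ 'e) \<times> real \<Rightarrow> real" where
  "coord e z = fst z $ e"

text \<open>Homogenized: \<open>snd z\<close> is the height, and at height 1 this is the slack in
  the inequality of S.\<close>

definition slack :: "'v set \<Rightarrow> (real ^ 'e) \<times> real \<Rightarrow> real" where
  "slack S z = snd z * (real (card S) - 1) - (\<Sum>e\<in>E_in S. fst z $ e)"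

lemma linear_coord: "linear (coord e)"
  by (rule linearI) (auto simp: coord_def)

lemma linear_slack: "linear (slack S)"
  by (rule linearI) (auto simp: slack_def algebra_simps sum.distrib simp flip: sum_distrib_left)

lemma block_iff:
  "block S \<longleftrightarrow> S \<subseteq> V \<and> 2 \<le> card S \<and> graph_connected S (induced S) \<and>
    (\<forall>v\<in>S. graph_connected (S - {v}) (induced (S - {v})))"
proof -
  have "S \<inter> (S - {v}) = S - {v}" for v by auto
  then show ?thesis by (simp add: two_connected_def induced_def induced_edges_induced_edges)
qed

lemma ends_nonempty: "e \<in> E \<Longrightarrow> ends e \<noteq> {}"
  using card_ends by fastforce

text \<open>Deleting one end leaves a single vertex, which is connected. These blocks determine the
  edge multiplicities and force the height to be nonnegative.\<close>

lemma block_edge: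
  assumes "e \<in> E"
  shows "block (ends e)"
proof -
  obtain u w where uw: "ends e = {u, w}" "u \<noteq> w" by (rule obtain_ends[OF assms])
  have "e \<in> E_in {u, w}" using assms uw by (simp add: E_in_def)
  then have "(u, w) \<in> reach (E_in {u, w})" using edge_reach assms uw(1) by blast
  then have "graph_connected {u, w} (induced {u, w})"
    using reach_sym by (auto simp: graph_connected_iff_reach)
  moreover have "graph_connected ({u, w} - {v}) (induced ({u, w} - {v}))" if "v \<in> {u, w}" for v
    using that uw(2) by (auto simp: graph_connected_iff_reach)
  ultimately show ?thesis
    unfolding block_iff using uw ends_subset[OF assms] by auto
qed

lemma block_E_in_nonempty:
  assumes "block S"
  shows "E_in S \<noteq> {}"
proof
  assume "E_in S = {}"
  then have "rank (E_in S) = 0" by (simp add: rank_empty)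
  moreover have "Suc (rank (E_in S)) = card S" "2 \<le> card S"
    using rank_connected[of S] assms unfolding block_iff by auto
  ultimately show False by simp
qed

lemma indep_insert:
  assumes "e \<in> E" "\<not> spans F e" "indep F"
  shows "indep (insert e F)" "e \<notin> F"
proof -
  show "e \<notin> F"
    using assms(1,2) edge_reach by (auto simp: spans_def)
  then show "indep (insert e F)"
    using rank_insert_not_spanned[OF assms(1,2)] assms(3) by (simp add: indep_def)
qed

lemma indep_empty: "indep {}"
  by (simp add: indep_def rank_empty)

lemma indep_singleton:
  assumes "e \<in> E"
  shows "indep {e}"
proof -
  obtain u w where uw: "ends e = {u, w}" "u \<noteq> w" by (rule obtain_ends[OF assms])
  have "\<not> spans {} e" using uw by (simp add: spans_iff[OF assms uw(1)] reach_def adj_def)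
  then show ?thesis using indep_insert[OF assms _ indep_empty] by simp
qed

lemma convex_P: "convex P"
  by (simp add: indep_polytope_def)

lemma ind_vec_lattice_point:
  assumes "indep F"
  shows "ind_vec F \<in> lattice_points P"
  using assms by (auto simp: lattice_points_def indep_polytope_def indicator_def intro!: hull_inc)

lemma ind_vec_cone: "indep F \<Longrightarrow> (ind_vec F, 1) \<in> polytope_cone P"
  using ind_vec_lattice_point by (intro cone_point) (simp add: lattice_points_def)

lemma zero_cone: "0 \<in> polytope_cone P"
  by (simp add: polytope_cone_def conic_hull_contains_0) (use zero_in_indep_polytope in blast)

lemma coord_nonneg: "z \<in> polytope_cone P \<Longrightarrow> 0 \<le> coord e z"
  by (cases z) (simp add: polytope_cone_iff coord_def)

lemma slack_nonneg: "block S \<Longrightarrow> z \<in> polytope_cone P \<Longrightarrow> 0 \<le> slack S z"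
  by (cases z) (simp add: polytope_cone_iff slack_def)

lemma coord_Ints: "z \<in> spanned_lattice P \<Longrightarrow> coord e z \<in> \<int>"
  by (rule spanned_lattice_form_Ints[OF linear_coord]) (auto simp: coord_def lattice_points_def)

lemma slack_Ints: "z \<in> spanned_lattice P \<Longrightarrow> slack S z \<in> \<int>"
  by (rule spanned_lattice_form_Ints[OF linear_slack]) (auto simp: slack_def lattice_points_def)

lemma cone_subset_subspace:
  assumes "subspace T" "\<And>F. indep F \<Longrightarrow> (ind_vec F, 1) \<in> T"
  shows "polytope_cone P \<subseteq> T"
proof -
  have "P \<subseteq> {x. (x, 1) \<in> T}"
    unfolding indep_polytope_def
  proof (rule hull_minimal)
    show "convex {x. (x, 1) \<in> T}"
    proof (rule convexI)
      fix x y :: "real ^ 'e" and u v :: real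
      assume *: "x \<in> {x. (x, 1) \<in> T}" "y \<in> {x. (x, 1) \<in> T}" "u + v = 1"
      then have "u *\<^sub>R (x, 1) + v *\<^sub>R (y, 1) \<in> T"
        using assms(1) by (auto simp del: scaleR_Pair intro: subspace_add subspace_scale)
      then show "u *\<^sub>R x + v *\<^sub>R y \<in> {x. (x, 1) \<in> T}" using *(3) by simp
    qed
  qed (use assms(2) in auto)
  then have "c *\<^sub>R (x, 1) \<in> T" if "x \<in> P" for c x
    using that assms(1) by (intro subspace_scale) auto
  then show ?thesis by (auto simp: polytope_cone_def conic_hull_explicit)
qed

text \<open>Forests avoiding e, the empty one included, lie on the face. A forest F containing e is
  recovered as (F - e) + {e} - {}, each term taken at height 1.\<close>

lemma coord_span:
  assumes "e \<in> E"
  shows "polytope_cone P \<subseteq> span (insert (ind_vec {e}, 1) {z \<in> polytope_cone P. coord e z = 0})"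
    (is "_ \<subseteq> span (insert ?w ?F)")
proof (rule cone_subset_subspace)
  fix F assume F: "indep F"
  have avoid: "(ind_vec B, 1) \<in> span (insert ?w ?F)" if "indep B" "e \<notin> B" for B
    using that ind_vec_cone by (intro span_base) (auto simp: coord_def)
  show "(ind_vec F, 1) \<in> span (insert ?w ?F)"
  proof (cases "e \<in> F")
    case True
    have "(ind_vec F, 1 :: real) = (ind_vec (F - {e}), 1) + (ind_vec {e}, 1) - (ind_vec {}, 1)"
      using ind_vec_insert[of e "F - {e}"] True by (simp add: insert_absorb zero_vec_def)
    also have "\<dots> \<in> span (insert ?w ?F)"
    proof (intro span_add span_diff)
      show "(ind_vec (F - {e}), 1) \<in> span (insert ?w ?F)"
        using indep_subset[OF F, of "F - {e}"] by (intro avoid) auto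
      show "(ind_vec {e}, 1) \<in> span (insert ?w ?F)" by (intro span_base) simp
      show "(ind_vec {}, 1) \<in> span (insert ?w ?F)" by (intro avoid indep_empty) simp
    qed
    finally show ?thesis .
  qed (use avoid F in blast)
qed simp

text \<open>If two edges e and f of S meet at v, then adding either one to a spanning tree of S - v yields
  spanning trees of S, so the unit vectors of e and f agree modulo the face; the connectedness of S
  then identifies the unit vectors of all its edges.\<close>

lemma slack_span:
  assumes S: "block S"
  shows "polytope_cone P \<subseteq> span (insert (0, 1) {z \<in> polytope_cone P. slack S z = 0})"
    (is "_ \<subseteq> ?T")
proof -
  define u :: "'e \<Rightarrow> (real ^ 'e) \<times> real" where "u e = (ind_vec {e}, 0)" for e
  have SV: "S \<subseteq> V" and card_S: "2 \<le> card S" and conn: "graph_connected S (induced S)"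
    and conn': "\<And>v. v \<in> S \<Longrightarrow> graph_connected (S - {v}) (induced (S - {v}))"
    using S unfolding block_iff by auto
  have finS: "finite S" using SV finite_V finite_subset by blast
  have sub: "subspace ?T" by simp
  have ind_u: "(ind_vec F, 1) = (\<Sum>e\<in>F. u e) + (0, 1)" for F
    by (simp add: u_def ind_vec_sum[of F] sum_prod)
  \<comment> \<open>A forest lies on the face when its part inside S is a spanning tree of S, that
    is, has |S| - 1 edges.\<close>
  have tight: "(ind_vec B, 1) \<in> ?T" if "indep B" "Suc (card (B \<inter> E_in S)) = card S" for B
  proof -
    have "(\<Sum>e\<in>E_in S. indicator B e :: real) = card (B \<inter> E_in S)"
      by (simp add: indicator_def sum.If_cases Int_commute)
    moreover have "real (card S) = real (card (B \<inter> E_in S)) + 1"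
      using that(2) by simp
    ultimately have "slack S (ind_vec B, 1) = 0"
      by (simp add: slack_def)
    then show ?thesis using that(1) ind_vec_cone by (intro span_base) auto
  qed
  have swap: "u e - u f \<in> ?T" if ef: "e \<in> E_in S" "f \<in> E_in S" "v \<in> ends e" "v \<in> ends f" for e f v
  proof -
    have v: "v \<in> S" using ef by (auto simp: E_in_def)
    obtain B where B: "B \<subseteq> E_in (S - {v})" "indep B" "rank B = rank (E_in (S - {v}))"
      using basis_exists by blast
    have "Suc (rank (E_in (S - {v}))) = card (S - {v})"
      using SV conn'[OF v] by (intro rank_connected) auto
    then have card_B: "Suc (Suc (card B)) = card S"
      using B v finS card_S by (simp add: indep_def)
    have tree: "(ind_vec (insert d B), 1) \<in> ?T \<and> d \<notin> B" if d: "d \<in> E_in S" "v \<in> ends d" for d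
    proof -
      have dE: "d \<in> E" using d by (simp add: E_in_def)
      obtain a b where ab: "ends d = {a, b}" "a \<noteq> b" by (rule obtain_ends[OF dE])
      have "\<not> spans B d"
        using reach_within[OF _ B(1), of a b] ab d(2) by (auto simp: spans_iff[OF dE ab(1)])
      note ins = indep_insert[OF dE this B(2)]
      have "insert d B \<inter> E_in S = insert d B"
        using d B(1) E_in_mono[of "S - {v}" S] by auto
      then show ?thesis using tight[OF ins(1)] ins(2) card_B by simp
    qed
    have "(ind_vec (insert e B), 1) - (ind_vec (insert f B), 1) \<in> ?T"
      using tree ef by (intro span_diff) auto
    then show ?thesis
      using tree ef by (simp add: u_def ind_vec_insert[of e B] ind_vec_insert[of f B])
  qed
  obtain T where T: "T \<subseteq> E_in S" "indep T" "rank T = rank (E_in S)"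
    using basis_exists by blast
  have card_T: "Suc (card T) = card S"
    using T rank_connected[OF SV conn] by (simp add: indep_def)
  have T_tight: "(ind_vec T, 1) \<in> ?T"
    using T card_T by (intro tight) (auto simp: Int_absorb2)
  have w: "(0, 1) \<in> ?T" by (intro span_base) simp
  have "u e \<in> ?T" if e: "e \<in> E_in S" for e
  proof -
    obtain a where a: "a \<in> ends e" using e ends_nonempty by (auto simp: E_in_def)
    have aS: "a \<in> S" using a e by (auto simp: E_in_def)
    have chain: "\<forall>f\<in>E_in S. y \<in> ends f \<longrightarrow> u f - u e \<in> ?T" if "(a, y) \<in> reach (E_in S)" for y
      using that unfolding reach_def
    proof (induction rule: rtrancl_induct)
      case base
      then show ?case using swap e a by blast
    next
      case (step y z)
      then obtain d where d: "d \<in> E_in S" "ends d = {y, z}" by (auto simp: adj_def)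
      then have "u d - u e \<in> ?T" using step.IH by auto
      moreover have "u f - u d \<in> ?T" if "f \<in> E_in S" "z \<in> ends f" for f
        using swap[of f d z] d that by auto
      ultimately show ?case using span_add[of "u _ - u d" _ "u d - u e"] by fastforce
    qed
    have diff: "u f - u e \<in> ?T" if f: "f \<in> E_in S" for f
    proof -
      obtain y where y: "y \<in> ends f" using f ends_nonempty by (auto simp: E_in_def)
      then have "y \<in> S" using f by (auto simp: E_in_def)
      then show ?thesis using chain[of y] conn aS f y unfolding graph_connected_iff_reach by blast
    qed
    \<comment> \<open>Modulo the span, the |S| - 1 unit vectors of the tree T are all equal to
      \<open>u e\<close>, and their sum is in the span; dividing by \<open>card T\<close> isolates
      \<open>u e\<close>.\<close>
    have "(\<Sum>f\<in>T. u f - u e) \<in> ?T" using T(1) diff by (intro span_sum) auto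
    then have "((ind_vec T, 1) - (0, 1)) - (\<Sum>f\<in>T. u f - u e) \<in> ?T"
      using T_tight w by (intro span_diff)
    also have "((ind_vec T, 1) - (0, 1)) - (\<Sum>f\<in>T. u f - u e) = real (card T) *\<^sub>R u e"
      unfolding ind_u by (simp add: sum_subtractf scaleR_conv_of_real sum_constant_scaleR)
    finally have "real (card T) *\<^sub>R u e \<in> ?T" .
    then have "(1 / real (card T)) *\<^sub>R real (card T) *\<^sub>R u e \<in> ?T" by (rule span_scale)
    moreover have "card T \<noteq> 0" using card_T card_S by linarith
    ultimately show ?thesis by simp
  qed
  \<comment> \<open>An edge with an end outside S can be added to T without a cycle and without
    changing the part inside S. So both forests lie on the face, and they differ by
    \<open>u e\<close>.\<close>
  moreover have "u e \<in> ?T" if e: "e \<in> E" "e \<notin> E_in S" for e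
  proof -
    obtain a b where ab: "ends e = {a, b}" "a \<noteq> b" by (rule obtain_ends[OF e(1)])
    have "\<not> spans T e"
      using reach_within[OF _ T(1), of a b] ab e by (auto simp: spans_iff[OF e(1) ab(1)] E_in_def)
    note ins = indep_insert[OF e(1) this T(2)]
    have "insert e T \<inter> E_in S = T" using T(1) e(2) by auto
    then have "(ind_vec (insert e T), 1) - (ind_vec T, 1) \<in> ?T"
      using card_T by (intro span_diff tight[OF ins(1)] T_tight) auto
    then show ?thesis using ins(2) by (simp add: u_def ind_vec_insert[of e T])
  qed
  ultimately have u: "u e \<in> ?T" if "e \<in> E" for e using that by blast
  show ?thesis
  proof (rule cone_subset_subspace[OF sub])
    fix F assume "indep F"
    then show "(ind_vec F, 1) \<in> ?T"
      unfolding ind_u using indep_subset_E u by (intro span_add span_sum w) auto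
  qed
qed

lemma ind_vec_spanned:
  assumes "e \<in> E"
  shows "(ind_vec {e}, 1) \<in> spanned_lattice P" "(ind_vec {}, 1) \<in> spanned_lattice P"
  using indep_singleton[OF assms] indep_empty
  by (simp_all only: lattice_point_in_spanned_lattice ind_vec_lattice_point)

text \<open>Each listed form cuts out a facet and agrees on the lattice with the reduced equation of
  that facet, so the Gorenstein condition can be read off from the forms themselves.\<close>

lemma gorenstein_point:
  assumes "delta_gorenstein \<delta> P"
  obtains v where "\<And>e. e \<in> E \<Longrightarrow> coord e (v, real \<delta>) = 1"
    "\<And>S. block S \<Longrightarrow> slack S (v, real \<delta>) = 1"
proof -
  obtain v where v: "v \<in> dilate_lattice_points \<delta> P"
    "\<And>F. F facet_of polytope_cone P \<Longrightarrow> \<exists>h. reduced_equation P F h \<and> h (v, real \<delta>) = 1"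
    using assms unfolding delta_gorenstein_def by blast
  have v': "(v, real \<delta>) \<in> spanned_lattice P"
    using v(1) by (simp add: dilate_lattice_points_def)
  have *: "g (v, real \<delta>) = 1"
    if g: "linear g" "\<And>z. z \<in> polytope_cone P \<Longrightarrow> 0 \<le> g z"
      "\<And>z. z \<in> spanned_lattice P \<Longrightarrow> g z \<in> \<int>"
      and w: "w \<in> polytope_cone P" "g w \<noteq> 0"
      "polytope_cone P \<subseteq> span (insert w {z \<in> polytope_cone P. g z = 0})"
      and ab: "a \<in> spanned_lattice P" "b \<in> spanned_lattice P" "g a - g b = 1"
    for g :: "(real ^ 'e) \<times> real \<Rightarrow> real" and w a b
  proof -
    have "{z \<in> polytope_cone P. g z = 0} facet_of polytope_cone P"
      using facet_of_nonneg_form[OF g(1,2) convex_polytope_cone[OF convex_P] zero_cone w] .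
    then obtain h where h: "reduced_equation P {z \<in> polytope_cone P. g z = 0} h" "h (v, real \<delta>) = 1"
      using v(2) by blast
    show ?thesis using reduced_equation_unique[OF h(1) g w ab v'] h(2) by simp
  qed
  show thesis
  proof
    fix e assume e: "e \<in> E"
    show "coord e (v, real \<delta>) = 1"
    proof (rule *[OF linear_coord coord_nonneg coord_Ints _ _ coord_span[OF e] ind_vec_spanned[OF e]])
      show "(ind_vec {e}, 1) \<in> polytope_cone P" by (intro ind_vec_cone indep_singleton e)
    qed (auto simp: coord_def)
  next
    fix S assume S: "block S"
    then obtain e where e: "e \<in> E_in S" using block_E_in_nonempty by blast
    then have eE: "e \<in> E" by (simp add: E_in_def)
    show "slack S (v, real \<delta>) = 1"
    \<comment> \<open>The two lattice points come in the opposite order to the coordinate case,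
      since an edge inside S lowers the slack by one.\<close>
    proof (rule *[OF linear_slack slack_nonneg[OF S] slack_Ints _ _ slack_span[OF S]
          ind_vec_spanned(2,1)[OF eE]])
      show "(0, 1) \<in> polytope_cone P" using ind_vec_cone[OF indep_empty] by (simp add: vec_lambda_zero)
      show "slack S (0, 1) \<noteq> 0" using S by (auto simp: slack_def two_connected_def)
      show "slack S (ind_vec {}, 1) - slack S (ind_vec {e}, 1) = 1"
        using e by (simp add: slack_def indicator_def)
    qed
  qed
qed

section \<open>Normality and sufficient conditions for the Gorenstein property\<close>

lemma normal_P: "normal_polytope P"
  unfolding normal_polytope_def
proof (intro allI impI ballI)
  fix k :: nat and x assume x: "x \<in> dilate_lattice_points k P"
  then have lat: "(x, real k) \<in> spanned_lattice P" by (simp add: dilate_lattice_points_def)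
  obtain y where y: "y \<in> P" "x = real k *\<^sub>R y" using x by (auto simp: dilate_lattice_points_def)
  have "\<exists>J. (\<forall>i<k. indep (J i)) \<and> x = (\<Sum>i<k. ind_vec (J i))"
  proof (rule decomposition_real)
    show "x $ e \<in> \<int>" for e using coord_Ints[OF lat, of e] by (simp add: coord_def)
    show "0 \<le> x $ e" for e using y by (simp add: indep_polytope_eq)
    show "(\<Sum>e\<in>A. x $ e) \<le> real k * real (rank A)" for A
      using y by (simp add: indep_polytope_eq mult_left_mono flip: sum_distrib_left)
  qed
  then obtain J where "\<forall>i<k. indep (J i)" "x = (\<Sum>i<k. ind_vec (J i))" by blast
  then show "\<exists>p. (\<forall>i<k. p i \<in> lattice_points P) \<and> x = (\<Sum>i<k. p i)"
    by (intro exI[of _ "\<lambda>i. ind_vec (J i)"]) (simp add: ind_vec_lattice_point)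
qed

lemma lattice_polytope_P: "lattice_polytope P"
proof -
  have "{ind_vec F | F. indep F} = ind_vec ` {F. indep F}" by auto
  then have "finite {ind_vec F | F. indep F}" by simp
  then show ?thesis
    unfolding lattice_polytope_def
  proof (intro exI[of _ "{ind_vec F | F. indep F}"] conjI)
    show "\<forall>x\<in>{ind_vec F | F. indep F}. \<forall>i. x $ i \<in> \<int>" by (auto simp: indicator_def)
  qed (use indep_polytope_def in auto)
qed

lemma all_ones_spanned: "(ind_vec E, real d) \<in> spanned_lattice P"
proof -
  define X :: "(real ^ 'e) set" where "X = (\<lambda>e. ind_vec {e}) ` E"
  \<comment> \<open>The single edges contribute height \<open>card E\<close>. The weight of the zero
    vector, the empty forest, corrects this to d and may be negative.\<close>
  define c :: "real ^ 'e \<Rightarrow> int" where "c x = (if x = 0 then int d - int (card E) else 1)" for x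
  have nz: "ind_vec {e} \<noteq> 0" for e :: 'e
    by (auto simp: vec_eq_iff indicator_def)
  have "(\<Sum>x\<in>insert 0 X. of_int (c x) *\<^sub>R (x, 1)) =
      of_int (c 0) *\<^sub>R (0, 1) + (\<Sum>x\<in>X. of_int (c x) *\<^sub>R (x, 1))"
    using nz by (intro sum.insert) (auto simp: X_def)
  also have "(\<Sum>x\<in>X. of_int (c x) *\<^sub>R (x, 1)) = (\<Sum>e\<in>E. (ind_vec {e}, 1))"
  proof -
    have "inj_on (\<lambda>e. ind_vec {e}) E"
      by (rule inj_onI) (rule ind_vec_singleton_inject[THEN iffD1])
    then show ?thesis
      unfolding X_def by (simp only: sum.reindex) (simp add: c_def nz)
  qed
  also have "\<dots> = (ind_vec E, real (card E))"
    by (simp add: ind_vec_sum[of E] sum_prod)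
  finally have "(ind_vec E, real d) = (\<Sum>x\<in>insert 0 X. of_int (c x) *\<^sub>R (x, 1))"
    by (simp add: c_def)
  moreover have "insert 0 X \<subseteq> lattice_points P"
    using ind_vec_lattice_point indep_singleton ind_vec_lattice_point[OF indep_empty]
    by (auto simp: X_def vec_lambda_zero)
  moreover have "finite (insert 0 X)" by (simp add: X_def)
  ultimately show ?thesis unfolding spanned_lattice_def by blast
qed

text \<open>The polytope is the origin and the cone a vertical ray. Its only facet is cut out by the
  height, which has value 1 at height \<delta> = 1.\<close>

lemma delta_gorenstein_edgeless:
  assumes "E = {}"
  shows "delta_gorenstein 1 P"
proof (rule delta_gorensteinI)
  show "polytope_cone P = {z \<in> {z. fst z = 0}. \<forall>h\<in>{snd}. 0 \<le> h z}"
  proof (intro set_eqI)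
    fix z :: "(real ^ 'e) \<times> real"
    show "z \<in> polytope_cone P \<longleftrightarrow> z \<in> {z \<in> {z. fst z = 0}. \<forall>h\<in>{snd}. 0 \<le> h z}"
      by (cases z) (auto simp: polytope_cone_iff assms E_in_def vec_eq_iff two_connected_def)
  qed
  show "subspace {z :: (real ^ 'e) \<times> real. fst z = 0}"
    by (intro linear_subspace_kernel) (simp add: linear_fst)
  show "linear h" if "h \<in> {snd}" for h :: "(real ^ 'e) \<times> real \<Rightarrow> real"
    using that by (simp add: linear_snd)
  show "h z \<in> \<int>" if "h \<in> {snd}" "z \<in> spanned_lattice P" for h z
    using that by (intro spanned_lattice_form_Ints[of h P z]) (auto simp: linear_snd)
  show "0 \<in> dilate_lattice_points 1 P"
    using all_ones_spanned[of 1] zero_in_indep_polytope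
    by (simp add: dilate_lattice_points_def assms vec_lambda_zero)
qed auto

lemma delta_gorenstein_blocks:
  assumes "E \<noteq> {}" and \<delta>: "\<And>S. block S \<Longrightarrow> real \<delta> * (real (card S) - 1) - real (card (E_in S)) = 1"
  shows "delta_gorenstein \<delta> P"
proof (rule delta_gorensteinI)
  define J where "J = coord ` E \<union> slack ` {S. block S}"
  \<comment> \<open>The equations for edge names outside the graph: they hold on the whole cone and
    belong to no facet.\<close>
  define L where "L = (\<Inter>e\<in>- E. {z. coord e z = 0})"
  show sub: "subspace L"
    unfolding L_def by (intro subspace_Inter) (auto intro: linear_subspace_kernel linear_coord)
  show C: "polytope_cone P = {z \<in> L. \<forall>h\<in>J. 0 \<le> h z}"
  proof (intro set_eqI)
    fix z :: "(real ^ 'e) \<times> real"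
    obtain x t where z: "z = (x, t)" by (cases z)
    have J: "(\<forall>h\<in>J. 0 \<le> h z) \<longleftrightarrow> (\<forall>e\<in>E. 0 \<le> x $ e) \<and>
        (\<forall>S. block S \<longrightarrow> (\<Sum>e\<in>E_in S. x $ e) \<le> t * (real (card S) - 1))"
      unfolding J_def z by (auto simp: ball_Un coord_def slack_def)
    have L: "z \<in> L \<longleftrightarrow> (\<forall>e. e \<notin> E \<longrightarrow> x $ e = 0)"
      by (auto simp: L_def z coord_def)
    \<comment> \<open>The condition t \<ge> 0 is not among the forms of \<open>J\<close>. It follows
      from the inequality of the ends of any edge, whose left side is nonnegative and whose right
      side is t.\<close>
    have "0 \<le> t" if zL: "z \<in> L" and zJ: "\<forall>h\<in>J. 0 \<le> h z"
    proof -
      obtain e where e: "e \<in> E" using assms(1) by blast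
      have "0 \<le> (\<Sum>d\<in>E_in (ends e). x $ d)"
        using zJ unfolding J by (intro sum_nonneg) (auto simp: E_in_def)
      also have "\<dots> \<le> t * (real (card (ends e)) - 1)"
        using zJ block_edge[OF e] unfolding J by blast
      finally show ?thesis using card_ends[OF e] by simp
    qed
    moreover have "0 \<le> x $ e" if "z \<in> L" "\<forall>h\<in>J. 0 \<le> h z" for e
      using that unfolding J L by (cases "e \<in> E") auto
    ultimately have "z \<in> L \<Longrightarrow> \<forall>h\<in>J. 0 \<le> h z \<Longrightarrow> z \<in> polytope_cone P"
      unfolding z polytope_cone_iff using J L z by blast
    moreover have "z \<in> polytope_cone P \<Longrightarrow> z \<in> L \<and> (\<forall>h\<in>J. 0 \<le> h z)"
      unfolding J L unfolding z polytope_cone_iff by blast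
    ultimately show "z \<in> polytope_cone P \<longleftrightarrow> z \<in> {z \<in> L. \<forall>h\<in>J. 0 \<le> h z}"
      by blast
  qed
  show "finite J"
    using finite_V by (auto simp: J_def intro!: finite_imageI intro: finite_subset[of _ "Pow V"])
  show "linear h" if "h \<in> J" for h
    using that linear_coord linear_slack by (auto simp: J_def)
  show "h z \<in> \<int>" if "h \<in> J" "z \<in> spanned_lattice P" for h z
    using that coord_Ints[of z] slack_Ints[of z] by (auto simp: J_def simp del: split_paired_All)
  show J1: "h (ind_vec E, real \<delta>) = 1" if "h \<in> J" for h
  proof -
    have "(\<Sum>e\<in>E_in S. indicator E e :: real) = card (E_in S)" for S
      by (subst sum.cong[OF refl, of _ _ "\<lambda>_. 1"]) (auto simp: E_in_def)
    then show ?thesis using that \<delta> by (auto simp: J_def coord_def slack_def)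
  qed
  have "(ind_vec E, real \<delta>) \<in> polytope_cone P"
    unfolding C using J1 by (auto simp: L_def coord_def)
  then show "ind_vec E \<in> dilate_lattice_points \<delta> P"
    using all_ones_spanned by (simp add: dilate_lattice_points_def polytope_cone_iff_dilate)
qed

end

theorem theorem2p2:
  fixes G :: "('v, 'e::finite) multigraph"
  assumes "loopless_multigraph G"
  shows "gorenstein (forest_polytope G) \<longleftrightarrow>
    (\<exists>\<delta>::nat. 2 \<le> \<delta> \<and>
      (\<exists>V E. simple_graph V E \<and> is_blow_up (\<delta> - 1) V E G \<and>
        (\<forall>S\<subseteq>V. two_connected S (induced_edges E S) \<longrightarrow>
          (int \<delta> - 1) * int (card (induced_edges E S)) + 1 = int \<delta> * (int (card S) - 1))))"
    (is "_ \<longleftrightarrow> (\<exists>\<delta>. ?R \<delta>)")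
proof -
  interpret loopless_graph G by unfold_locales (rule assms)
  have simple: "simple_graph V (ends ` E)"
    using finite_V ends_subset card_ends by (auto simp: simple_graph_def)
  have card_E_in: "card (E_in S) = m * card (induced S)"
    if m: "\<And>d. d \<in> ends ` E \<Longrightarrow> card {e \<in> E. ends e = d} = m" for m S
  proof -
    have "card (E_in S) = (\<Sum>d\<in>induced S. card {e \<in> E_in S. ends e = d})"
      unfolding card_eq_sum by (rule sum.group[symmetric]) (auto simp: induced_eq)
    also have "\<dots> = (\<Sum>d\<in>induced S. m)"
    proof (rule sum.cong[OF refl])
      fix d assume "d \<in> induced S"
      then have "d \<in> ends ` E" "{e \<in> E_in S. ends e = d} = {e \<in> E. ends e = d}"
        by (auto simp: induced_eq E_in_def)
      then show "card {e \<in> E_in S. ends e = d} = m" using m by simp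
    qed
    finally show ?thesis by simp
  qed
  show ?thesis
  proof
    assume "gorenstein (forest_polytope G)"
    then obtain \<delta> where "delta_gorenstein \<delta> P"
      by (auto simp: gorenstein_def forest_polytope_eq)
    then obtain v where v: "\<And>e. e \<in> E \<Longrightarrow> coord e (v, real \<delta>) = 1"
      "\<And>S. block S \<Longrightarrow> slack S (v, real \<delta>) = 1"
      by (rule gorenstein_point) blast
    have bl: "real \<delta> * (real (card S) - 1) = real (card (E_in S)) + 1" if "block S" for S
    proof -
      have "(\<Sum>e\<in>E_in S. v $ e) = (\<Sum>e\<in>E_in S. 1)"
        using v(1) by (intro sum.cong) (auto simp: E_in_def coord_def)
      then show ?thesis using v(2)[OF that] by (simp add: slack_def)
    qed
    have fib: "card {e \<in> E. ends e = d} + 1 = \<delta>" if "d \<in> ends ` E" for d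
    proof -
      obtain e where e: "e \<in> E" "d = ends e" using \<open>d \<in> ends ` E\<close> by blast
      have "E_in d = {e \<in> E. ends e = d}"
        using e card_ends card_subset_eq[of d] card_ge_0_finite[of d]
        by (auto simp: E_in_def)
      then have "real \<delta> = real (card {e \<in> E. ends e = d} + 1)"
        using bl[OF block_edge[OF e(1)]] e card_ends by simp
      then show ?thesis by linarith
    qed
    show "\<exists>\<delta>. ?R \<delta>"
    \<comment> \<open>Without edges the given \<delta> may be 1. There are then no blocks, the
      equations are vacuous, and 2 serves as the witness.\<close>
    proof (cases "E = {}")
      case True
      have "\<not> block S" for S
        using block_E_in_nonempty[of S] True by (auto simp: E_in_def)
      then show ?thesis
        using simple True
        by (intro exI[of _ 2] conjI exI[of _ V] exI[of _ "ends ` E"])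
          (auto simp: is_blow_up_def induced_def)
    next
      case False
      then obtain e where e: "e \<in> E" by blast
      have "card {d \<in> E. ends d = ends e} > 0" using e by (auto simp: card_gt_0_iff)
      then have "2 \<le> \<delta>" using fib[of "ends e"] e by auto
      moreover have "is_blow_up (\<delta> - 1) V (ends ` E) G"
        using fib unfolding is_blow_up_def by fastforce
      moreover have "(int \<delta> - 1) * int (card (induced S)) + 1 = int \<delta> * (int (card S) - 1)"
        if "block S" for S
      proof -
        have "card (E_in S) = (\<delta> - 1) * card (induced S)"
          using fib by (intro card_E_in) fastforce
        then have "real_of_int (int \<delta> * (int (card S) - 1)) =
            real_of_int ((int \<delta> - 1) * int (card (induced S)) + 1)"
          using bl[OF that] \<open>2 \<le> \<delta>\<close> by (simp add: of_nat_diff)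
        then show ?thesis by linarith
      qed
      ultimately show ?thesis
        using simple
        by (intro exI[of _ \<delta>] conjI exI[of _ V] exI[of _ "ends ` E"]) (auto simp: induced_def)
    qed
  next
    assume "\<exists>\<delta>. ?R \<delta>"
    then obtain \<delta> V' E' where \<delta>: "2 \<le> \<delta>" "simple_graph V' E'" "is_blow_up (\<delta> - 1) V' E' G"
      "\<forall>S\<subseteq>V'. two_connected S (induced_edges E' S) \<longrightarrow>
          (int \<delta> - 1) * int (card (induced_edges E' S)) + 1 = int \<delta> * (int (card S) - 1)"
      by blast
    have V': "V' = V" and fib: "\<And>d. d \<in> E' \<Longrightarrow> card {e \<in> E. ends e = d} = \<delta> - 1"
      using \<delta>(3) by (auto simp: is_blow_up_def)
    have E': "E' = ends ` E"
    proof
      show "ends ` E \<subseteq> E'" using \<delta>(3) by (auto simp: is_blow_up_def)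
      \<comment> \<open>Since \<delta> - 1 > 0, every edge of the simple graph is represented in G,
        so that graph is the underlying simple graph of G.\<close>
      show "E' \<subseteq> ends ` E"
      proof
        fix d assume "d \<in> E'"
        then have "card {e \<in> E. ends e = d} \<noteq> 0" using fib \<delta>(1) by fastforce
        then have "{e \<in> E. ends e = d} \<noteq> {}" by force
        then show "d \<in> ends ` E" by blast
      qed
    qed
    have "real \<delta> * (real (card S) - 1) - real (card (E_in S)) = 1" if S: "block S" for S
    proof -
      have "card (E_in S) = (\<delta> - 1) * card (induced S)"
        using fib by (intro card_E_in) (simp add: E')
      moreover have "(int \<delta> - 1) * int (card (induced S)) + 1 = int \<delta> * (int (card S) - 1)"
        using \<delta>(4) S unfolding V' E' induced_def by blast
      then have "real_of_int ((int \<delta> - 1) * int (card (induced S)) + 1) =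
          real_of_int (int \<delta> * (int (card S) - 1))" by simp
      ultimately show ?thesis using \<delta>(1) by (simp add: of_nat_diff)
    qed
    then have "\<exists>\<delta>>0. delta_gorenstein \<delta> P"
      using delta_gorenstein_edgeless delta_gorenstein_blocks[of \<delta>] \<delta>(1)
      by (metis zero_less_one pos2 less_le_trans)
    then show "gorenstein (forest_polytope G)"
      unfolding gorenstein_def forest_polytope_eq using normal_P lattice_polytope_P by blast
  qed
qed

end
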